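(* The reproducing kernel $K_x(y)$ ($x,y\in\mathbb{R}$) of $\mathcal{H}$ is given by $$K_x(y)=\sqrt2\,\pi\, e^{-\pi(x^2+y^2)}\int_0^1\frac{t^{2\pi-1/2}}{\sqrt{1-t^2}}\,e^{2\pi\frac{2xyt-(x^2+y^2)t^2}{1-t^2}}\,dt.$$
   Context: The Fourier transform is $\hat f(t)=\int_{\mathbb{R}} f(x)e^{-2\pi i t x}\,dx$. The Fourier symmetric Sobolev space $\mathcal{H}$ is the Hilbert space of functions $f$ on $\mathbb{R}$ with $$\|f\|_{\mathcal{H}}^2=\int_{\mathbb{R}}|f(x)|^2(1+x^2)\,dx+\int_{\mathbb{R}}|\hat f(\xi)|^2(1+\xi^2)\,d\xi<\infty,$$ with inner product $\langle f,g\rangle_{\mathcal{H}}=\int_{\mathbb{R}} f\overline{g}(1+x^2)\,dx+\int_{\mathbb{R}}\hat f\,\overline{\hat g}(1+\xi^2)\,d\xi$. It is a reproducing kernel Hilbert space; its reproducing kernel at $x\in\mathbb{R}$ is the function $K_x\in\mathcal{H}$ with $f(x)=\langle f,K_x\rangle_{\mathcal{H}}$ for all $f\in\mathcal{H}$. *)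

theory Defs
  imports "HOL-Analysis.Analysis"
begin

definition fourier :: "(real \<Rightarrow> complex) \<Rightarrow> real \<Rightarrow> complex" where
  "fourier f t = (LINT x|lborel. f x * exp (- (2 * complex_of_real pi * \<i> * complex_of_real t * complex_of_real x)))"

text \<open>
  Finiteness of the first integral already forces \<open>f \<in> L\<^sup>1\<close> (Cauchy-Schwarz), so the Fourier
  integral converges absolutely; finiteness of the second then gives \<open>fourier f \<in> L\<^sup>1\<close>, so that
  every almost-everywhere class of functions of finite norm has exactly one continuous
  representative. Point evaluation refers to that representative; the space is therefore
  rendered as the set of these continuous functions.
\<close>

definition sobolev_H :: "(real \<Rightarrow> complex) set" where
  "sobolev_H = {f. continuous_on UNIV f
     \<and> integrable lborel (\<lambda>x. (cmod (f x))\<^sup>2 * (1 + x\<^sup>2))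
     \<and> integrable lborel (\<lambda>\<xi>. (cmod (fourier f \<xi>))\<^sup>2 * (1 + \<xi>\<^sup>2))}"

definition inner_H :: "(real \<Rightarrow> complex) \<Rightarrow> (real \<Rightarrow> complex) \<Rightarrow> complex" where
  "inner_H f g =
     (LINT x|lborel. f x * cnj (g x) * complex_of_real (1 + x\<^sup>2))
   + (LINT \<xi>|lborel. fourier f \<xi> * cnj (fourier g \<xi>) * complex_of_real (1 + \<xi>\<^sup>2))"

definition is_reproducing_kernel_at :: "real \<Rightarrow> (real \<Rightarrow> complex) \<Rightarrow> bool" where
  "is_reproducing_kernel_at x k \<longleftrightarrow> k \<in> sobolev_H \<and> (\<forall>f\<in>sobolev_H. f x = inner_H f k)"

end

theory Submission
  imports Defs "HOL-Probability.Characteristic_Functions" "HOL-Probability.Sinc_Integral"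
    "HOL-Real_Asymp.Real_Asymp"
begin

text \<open>
  The kernel is \<open>K\<^sub>x = \<integral>\<^sub>0\<^sup>1 \<pi> t\<^bsup>2\<pi>-1/2\<^esup> M\<^sub>t(x, \<cdot>) dt\<close> for the Mehler kernel \<open>M\<^sub>t\<close> of the Hermite operator.
  The transform of \<open>M\<^sub>t(x, \<cdot>)\<close> is an explicit Gaussian, so exchanging integrals turns the Fourier part
  of \<open>\<langle>f, M\<^sub>t(x, \<cdot>)\<rangle>\<close> into \<open>\<integral> f (1 - \<partial>\<^sub>y\<^sup>2/4\<pi>\<^sup>2) M\<^sub>t(x, y) dy\<close> without any inversion theorem for \<open>f\<close>. Since
  \<open>\<pi> t\<^bsup>2\<pi>-1/2\<^esup> (2 + y\<^sup>2 - \<partial>\<^sub>y\<^sup>2/4\<pi>\<^sup>2) M\<^sub>t = \<partial>\<^sub>t (t\<^bsup>2\<pi>+1/2\<^esup> M\<^sub>t)\<close>, integrating over \<open>t\<close> gives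
  \<open>\<langle>f, K\<^sub>x\<rangle>\<close> as the limit of \<open>\<integral> f(y) M\<^sub>t(x, y) dy\<close> for \<open>t \<rightarrow> 1\<close>, which is \<open>f x\<close> because \<open>M\<^sub>t\<close> is an
  approximate identity.
  Uniqueness follows by expanding the norm of the difference of two kernels.
\<close>

subsection \<open>Integrability and Gaussian integrals\<close>

text \<open>Origin of the weight: let h_n be the Hermite functions normalised for exp(-pi y^2). They
  satisfy (2 + y^2 - D^2/(4 pi^2)) h_n = (n + 2 pi + 1/2)/pi h_n, and this operator represents the
  norm, so K_x(y) should be the sum of pi/(n + 2 pi + 1/2) h_n(x) h_n(y). Writing 1/(n + 2 pi + 1/2)
  as the integral of t^(n + 2 pi - 1/2) over (0,1) and summing t^n h_n(x) h_n(y) by Mehler's formula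
  gives the stated integral. The proof works only with the closed Gaussian forms. The obstacle is
  the end t = 1, where the bound on (1 + y^2 + \<open>mehler_symbol\<close>) M_t blows up.
  Exchanging the t-integral with the inner product is therefore justified for its two halves
  separately. On the position side M_t has only the integrable singularity (1 - t)^(-1/2); on the
  frequency side, integrating exp(-pi xi^2 (1 - t)) over t gains the factor 1/(1 + xi^2) that pays
  for the weight. The evolution equation is used only on compact subintervals of (0,1).\<close>

text \<open>A majorant that splits into one function of each variable justifies all exchanges of
  integrals below except that of \<open>\<Psi>\<close> in
  \<open>inner_H_mehler_kernel\<close>.\<close>

lemma integrable_product_bound:
  fixes F :: "real \<Rightarrow> real \<Rightarrow> 'b::{banach, second_countable_topology}"
  assumes F': "case_prod F \<in> borel_measurable (borel \<Otimes>\<^sub>M borel)"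
    and g: "integrable lborel (g :: real \<Rightarrow> real)" and h: "integrable lborel (h :: real \<Rightarrow> real)"
    and le: "\<And>x y. norm (F x y) \<le> g x * h y"
  shows "integrable (lborel \<Otimes>\<^sub>M lborel) (case_prod F)"
proof (rule lborel_pair.Fubini_integrable)
  have F[measurable]: "case_prod F \<in> borel_measurable (lborel \<Otimes>\<^sub>M lborel)"
    using F' by (simp add: lborel_prod borel_prod)
  then show "case_prod F \<in> borel_measurable (lborel \<Otimes>\<^sub>M lborel)" .
  have int2: "integrable lborel (F x)" for x
  proof (rule Bochner_Integration.integrable_bound)
    show "integrable lborel (\<lambda>y. g x * h y)"
      using h by simp
    show "F x \<in> borel_measurable lborel"
      using measurable_Pair2[OF F, of x] by simp
    show "AE y in lborel. norm (F x y) \<le> norm (g x * h y)"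
      by (rule AE_I2) (metis le abs_ge_self order_trans real_norm_def)
  qed
  then show "AE x in lborel. integrable lborel (\<lambda>y. case_prod F (x, y))"
    by simp
  show "integrable lborel (\<lambda>x. LINT y|lborel. norm (case_prod F (x, y)))"
  proof (rule Bochner_Integration.integrable_bound[OF integrable_mult_left[OF g, of "integral\<^sup>L lborel h"]])
    have "(LINT y|lborel. norm (F x y)) \<le> g x * integral\<^sup>L lborel h" for x
    proof -
      have "(LINT y|lborel. norm (F x y)) \<le> (LINT y|lborel. g x * h y)"
        using int2 h le by (intro integral_mono) auto
      then show ?thesis by simp
    qed
    then have "norm (LINT y|lborel. norm (F x y)) \<le> norm (g x * integral\<^sup>L lborel h)" for x
      by (simp add: order.trans[OF _ abs_ge_self])
    then show "AE x in lborel. norm (LINT y|lborel. norm (case_prod F (x, y))) \<le> norm (g x * integral\<^sup>L lborel h)"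
      by simp
  qed (use F in measurable)
qed

lemma integrable_inverse_one_plus_square: "integrable lborel (\<lambda>x::real. 1 / (1 + x\<^sup>2))"
  using integrable_inverse_1_plus_square
  by (simp add: set_integrable_def inverse_eq_divide)

text \<open>Stands in for integration by parts when the second moment of a Gaussian is
  computed.\<close>

lemma integral_derivative_eq_0:
  fixes F f :: "real \<Rightarrow> complex"
  assumes F: "\<And>y. (F has_vector_derivative f y) (at y)"
    and cont: "continuous_on UNIV f" and int: "integrable lborel f"
    and lim: "(F \<longlongrightarrow> 0) at_top" "(F \<longlongrightarrow> 0) at_bot"
  shows "(LINT y|lborel. f y) = 0"
proof -
  have "(LBINT y=-\<infinity>..\<infinity>. f y) = 0 - 0"
  proof (rule interval_integral_FTC_integrable[where F = F])
    show "isCont f x" for x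
      using cont by (simp add: continuous_on_eq_continuous_at)
    show "((F \<circ> real_of_ereal) \<longlongrightarrow> 0) (at_right (-\<infinity>))" "((F \<circ> real_of_ereal) \<longlongrightarrow> 0) (at_left \<infinity>)"
      using lim by (simp_all add: ereal_tendsto_simps)
  qed (use assms in \<open>simp_all add: set_integrable_def\<close>)
  then show ?thesis
    by (simp add: interval_lebesgue_integral_def set_lebesgue_integral_def)
qed

lemma integrable_one_plus_square_gaussian:
  fixes a r :: real
  assumes a: "a > 0"
  shows "integrable lborel (\<lambda>y. (1 + y\<^sup>2) * exp (- a * y\<^sup>2 + r * y))"
proof -
  define \<mu> \<sigma> where "\<mu> = r / (2 * a)" and "\<sigma> = 1 / sqrt (2 * a)"
  have \<sigma>: "\<sigma> > 0" using a by (simp add: \<sigma>_def)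
  have \<sigma>2: "\<sigma>\<^sup>2 = 1 / (2 * a)" using a by (simp add: \<sigma>_def power_divide)
  define C where "C = sqrt (2 * pi * \<sigma>\<^sup>2) * exp (a * \<mu>\<^sup>2)"
  have eq: "exp (- a * y\<^sup>2 + r * y) = C * normal_density \<mu> \<sigma> y" for y
  proof -
    have "(y - \<mu>)\<^sup>2 / (2 * \<sigma>\<^sup>2) = a * (y - \<mu>)\<^sup>2" "r = 2 * a * \<mu>"
      using a by (simp_all add: \<sigma>2 \<mu>_def)
    then have "- a * y\<^sup>2 + r * y = a * \<mu>\<^sup>2 + (- (y - \<mu>)\<^sup>2 / (2 * \<sigma>\<^sup>2))"
      by (simp only: minus_divide_left[symmetric]) (simp add: power2_eq_square algebra_simps)
    then show ?thesis
      using \<sigma> by (simp only: exp_add C_def normal_density_def) simp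
  qed
  \<comment> \<open>Expansion of 1 + y^2 around the mean: (1 + \<mu>^2) + 2 \<mu> (y - \<mu>) + (y -
    \<mu>)^2, so that only central moments occur.\<close>
  have "integrable lborel (\<lambda>y. C * (1 + \<mu>\<^sup>2) * (normal_density \<mu> \<sigma> y * (y - \<mu>) ^ 0)
      + C * 2 * \<mu> * (normal_density \<mu> \<sigma> y * (y - \<mu>) ^ 1) + C * (normal_density \<mu> \<sigma> y * (y - \<mu>) ^ 2))"
    by (intro Bochner_Integration.integrable_add integrable_mult_right integrable_normal_moment \<sigma>)
  then show ?thesis
    by (rule back_subst[of "integrable lborel"])
       (simp only: eq, auto simp: power2_eq_square algebra_simps fun_eq_iff)
qed

lemma integrable_gaussian_poly:
  fixes a :: real and b :: complex and p :: "real \<Rightarrow> complex"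
  assumes a: "a > 0" and p: "p \<in> borel_measurable borel" and le: "\<And>y. norm (p y) \<le> C * (1 + y\<^sup>2)"
  shows "integrable lborel (\<lambda>y. p y * exp (complex_of_real (- a * y\<^sup>2) + b * complex_of_real y))"
proof (rule Bochner_Integration.integrable_bound)
  show "integrable lborel (\<lambda>y. C * ((1 + y\<^sup>2) * exp (- a * y\<^sup>2 + Re b * y)))"
    using a by (intro integrable_mult_right integrable_one_plus_square_gaussian)
  show "AE y in lborel. norm (p y * exp (complex_of_real (- a * y\<^sup>2) + b * complex_of_real y))
     \<le> norm (C * ((1 + y\<^sup>2) * exp (- a * y\<^sup>2 + Re b * y)))"
  proof (rule AE_I2)
    fix y
    have "norm (p y) * exp (- a * y\<^sup>2 + Re b * y) \<le> C * (1 + y\<^sup>2) * exp (- a * y\<^sup>2 + Re b * y)"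
      by (intro mult_right_mono le) auto
    then show "norm (p y * exp (complex_of_real (- a * y\<^sup>2) + b * complex_of_real y))
     \<le> norm (C * ((1 + y\<^sup>2) * exp (- a * y\<^sup>2 + Re b * y)))"
      by (simp add: norm_mult mult.assoc order.trans[OF _ abs_ge_self])
  qed
  show "(\<lambda>y. p y * exp (complex_of_real (- a * y\<^sup>2) + b * complex_of_real y)) \<in> borel_measurable lborel"
    using p by measurable
qed

lemma gaussian_integral:
  fixes a :: real and b :: complex
  assumes a: "a > 0"
  shows "(LINT y|lborel. exp (complex_of_real (- a * y\<^sup>2) + b * complex_of_real y))
    = complex_of_real (sqrt (pi / a)) * exp (b\<^sup>2 / (4 * complex_of_real a))"
proof -
  \<comment> \<open>The substitution y = t + c x stays on the real line: t is where the modulus of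
    the integrand is largest, and c rescales it to the standard normal density. The imaginary part
    of b survives only as the argument of the characteristic function of that density.\<close>
  define c t where "c = 1 / sqrt (2 * a)" and "t = Re b / (2 * a)"
  have c: "c > 0" using a by (simp add: c_def)
  have c2: "c * c = 1 / (2 * a)" using a by (simp add: c_def)
  define k where "k = exp (b * complex_of_real t - complex_of_real (a * t\<^sup>2))"
  have eq: "exp (complex_of_real (- a * (t + c * x)\<^sup>2) + b * complex_of_real (t + c * x))
      = (k * sqrt (2 * pi)) * (complex_of_real (std_normal_density x) * iexp (Im b * c * x))" for x
  proof -
    have "a * (c * c) = 1/2" using a c2 by simp
    then have "- a * (t + c * x)\<^sup>2 + Re b * (t + c * x) = (Re b * t - a * t\<^sup>2) + (- x\<^sup>2 / 2)"
      using a unfolding t_def power2_eq_square by (simp add: algebra_simps)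
    then have "complex_of_real (- a * (t + c * x)\<^sup>2) + b * complex_of_real (t + c * x)
      = (b * complex_of_real t - complex_of_real (a * t\<^sup>2)) + complex_of_real (- x\<^sup>2 / 2) + \<i> * complex_of_real (Im b * c * x)"
      by (simp add: complex_eq_iff algebra_simps)
    then show ?thesis
      by (simp only: exp_add k_def exp_of_real std_normal_density_def of_real_mult) (simp add: field_simps)
  qed
  have *: "(LINT x|lborel. complex_of_real (std_normal_density x) * iexp (Im b * c * x)) = exp (- ((Im b * c)\<^sup>2) / 2)"
    using fun_cong[OF char_std_normal_distribution, of "Im b * c"]
    by (simp add: char_def integral_density scaleR_conv_of_real)
  have "(LINT y|lborel. exp (complex_of_real (- a * y\<^sup>2) + b * complex_of_real y))
     = c *\<^sub>R (LINT x|lborel. exp (complex_of_real (- a * (t + c * x)\<^sup>2) + b * complex_of_real (t + c * x)))"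
    using c by (subst lborel_integral_real_affine[where c = c and t = t]) auto
  also have "\<dots> = complex_of_real (c * sqrt (2 * pi)) * (k * exp (- ((Im b * c)\<^sup>2) / 2))"
    unfolding eq integral_mult_right_zero * by (simp add: scaleR_conv_of_real)
  also have "c * sqrt (2 * pi) = sqrt (pi / a)"
    using a by (simp add: c_def real_sqrt_mult real_sqrt_divide)
  also have "k * exp (- ((Im b * c)\<^sup>2) / 2) = exp (b\<^sup>2 / (4 * complex_of_real a))"
  proof -
    have "(Im b * c)\<^sup>2 = (Im b)\<^sup>2 / (2 * a)"
      using a by (simp add: c_def power_mult_distrib power_divide)
    moreover have "Re b = 2 * a * t"
      using a by (simp add: t_def)
    then have "b\<^sup>2 = 4 * complex_of_real a * (b * complex_of_real t - complex_of_real (a * t\<^sup>2)) - complex_of_real ((Im b)\<^sup>2)"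
      by (simp add: complex_eq_iff power2_eq_square algebra_simps)
    then have "b\<^sup>2 / (4 * complex_of_real a) = (b * complex_of_real t - complex_of_real (a * t\<^sup>2)) - complex_of_real ((Im b)\<^sup>2 / (4 * a))"
      using a by (simp add: diff_divide_distrib)
    ultimately have "b\<^sup>2 / (4 * complex_of_real a) = (b * complex_of_real t - complex_of_real (a * t\<^sup>2)) + complex_of_real (- ((Im b * c)\<^sup>2) / 2)"
      by simp
    then show ?thesis
      unfolding k_def by (metis exp_add exp_of_real)
  qed
  finally show ?thesis .
qed

lemma gaussian_decay:
  fixes a r :: real
  assumes a: "a > 0"
  shows "((\<lambda>y. (1 + \<bar>y\<bar>) * exp (- a * y\<^sup>2 + r * y)) \<longlongrightarrow> 0) at_top"
    "((\<lambda>y. (1 + \<bar>y\<bar>) * exp (- a * y\<^sup>2 + r * y)) \<longlongrightarrow> 0) at_bot"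
  using a by real_asymp+

lemma gaussian_second_moment:
  fixes a :: real and b :: complex
  assumes a: "a > 0"
  shows "(LINT y|lborel. complex_of_real (1 + y\<^sup>2) * exp (complex_of_real (- a * y\<^sup>2) + b * complex_of_real y))
    = (1 + 1 / (2 * complex_of_real a) + b\<^sup>2 / (4 * (complex_of_real a)\<^sup>2))
      * (complex_of_real (sqrt (pi / a)) * exp (b\<^sup>2 / (4 * complex_of_real a)))"
proof -
  define E where "E y = exp (complex_of_real (- a * y\<^sup>2) + b * complex_of_real y)" for y
  \<comment> \<open>The ansatz is that (\<alpha> y + \<beta>) E(y) is an antiderivative of (y^2 -
    \<gamma>) E(y). Comparing the coefficients of y^2, y and 1 determines \<alpha>, \<beta> and
    \<gamma>.\<close>
  define \<alpha> \<beta> \<gamma> where "\<alpha> = - 1 / (2 * complex_of_real a)" and "\<beta> = - b / (4 * (complex_of_real a)\<^sup>2)"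
    and "\<gamma> = 1 / (2 * complex_of_real a) + b\<^sup>2 / (4 * (complex_of_real a)\<^sup>2)"
  have le1: "norm (complex_of_real (1 + y\<^sup>2)) \<le> 1 * (1 + y\<^sup>2)" for y :: real
    by (simp only: norm_of_real mult_1) simp
  have int1: "integrable lborel (\<lambda>y. complex_of_real (1 + y\<^sup>2) * E y)"
    unfolding E_def by (rule integrable_gaussian_poly[OF a _ le1]) measurable
  have int0: "integrable lborel (\<lambda>y. 1 * E y)"
    unfolding E_def by (rule integrable_gaussian_poly[OF a, where C = 1]) auto
  have "(LINT y|lborel. complex_of_real (1 + y\<^sup>2) * E y - (1 + \<gamma>) * E y) = 0"
  proof (rule integral_derivative_eq_0[where F = "\<lambda>y. (\<alpha> * complex_of_real y + \<beta>) * E y"])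
    fix y :: real
    have E': "(E has_vector_derivative (b - 2 * complex_of_real a * y) * E y) (at y)"
    proof -
      have "((\<lambda>y. - a * y\<^sup>2) has_real_derivative - a * (2 * y)) (at y)"
        by (auto intro!: derivative_eq_intros)
      then have "((\<lambda>y. complex_of_real (- a * y\<^sup>2)) has_vector_derivative complex_of_real (- a * (2 * y))) (at y)"
        by (intro has_vector_derivative_of_real) (simp add: has_real_derivative_iff_has_vector_derivative)
      moreover have "((\<lambda>y. b * complex_of_real y) has_vector_derivative b * 1) (at y)"
        by (intro has_vector_derivative_mult_right) (auto intro!: derivative_eq_intros)
      ultimately have "((\<lambda>y. complex_of_real (- a * y\<^sup>2) + b * complex_of_real y) has_vector_derivative
          complex_of_real (- a * (2 * y)) + b * 1) (at y)"
        by (rule has_vector_derivative_add)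
      from field_vector_diff_chain_at[OF this DERIV_exp] show ?thesis
        by (simp add: E_def[abs_def] o_def algebra_simps)
    qed
    have "\<alpha> * b = 2 * complex_of_real a * \<beta>" "2 * complex_of_real a * \<alpha> = - 1" "\<gamma> = - \<alpha> - \<beta> * b"
      using a by (simp_all add: \<alpha>_def \<beta>_def \<gamma>_def power2_eq_square field_simps)
    moreover have "((\<lambda>y. (\<alpha> * complex_of_real y + \<beta>) * E y) has_vector_derivative
        (\<alpha> * complex_of_real y + \<beta>) * ((b - 2 * complex_of_real a * y) * E y) + \<alpha> * E y) (at y)"
      by (rule has_vector_derivative_mult[OF _ E']) (auto intro!: derivative_eq_intros)
    moreover have "complex_of_real (1 + y\<^sup>2) * E y - (1 + (- \<alpha> - \<beta> * b)) * E y
        = (\<alpha> * complex_of_real y + \<beta>) * ((b - 2 * complex_of_real a * y) * E y) + \<alpha> * E y"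
      if h: "\<alpha> * b = 2 * complex_of_real a * \<beta>" "2 * complex_of_real a * \<alpha> = - 1"
    proof -
      have "(\<alpha> * complex_of_real y + \<beta>) * (b - 2 * complex_of_real a * y) + \<alpha>
         = (\<alpha> * b - 2 * complex_of_real a * \<beta>) * y - (2 * complex_of_real a * \<alpha>) * y\<^sup>2 + \<beta> * b + \<alpha>"
        by (simp add: algebra_simps power2_eq_square)
      also have "\<dots> = complex_of_real (1 + y\<^sup>2) - (1 + (- \<alpha> - \<beta> * b))"
        unfolding h by simp
      finally show ?thesis
        by (simp only: left_diff_distrib[symmetric] distrib_right[symmetric] mult.assoc[symmetric])
    qed
    ultimately show "((\<lambda>y. (\<alpha> * complex_of_real y + \<beta>) * E y) has_vector_derivative
        complex_of_real (1 + y\<^sup>2) * E y - (1 + \<gamma>) * E y) (at y)"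
      by simp
  next
    show "continuous_on UNIV (\<lambda>y. complex_of_real (1 + y\<^sup>2) * E y - (1 + \<gamma>) * E y)"
      unfolding E_def by (intro continuous_intros)
    show "integrable lborel (\<lambda>y. complex_of_real (1 + y\<^sup>2) * E y - (1 + \<gamma>) * E y)"
      using int1 int0 by simp
    have le: "norm ((\<alpha> * complex_of_real y + \<beta>) * E y)
        \<le> (norm \<alpha> + norm \<beta>) * ((1 + \<bar>y\<bar>) * exp (- a * y\<^sup>2 + Re b * y))" for y
    proof -
      have "norm (\<alpha> * complex_of_real y + \<beta>) \<le> norm \<alpha> * \<bar>y\<bar> + norm \<beta>"
        by (rule order.trans[OF norm_triangle_ineq]) (simp add: norm_mult)
      also have "\<dots> \<le> (norm \<alpha> + norm \<beta>) * (1 + \<bar>y\<bar>)"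
        by (simp add: algebra_simps)
      finally have "norm (\<alpha> * complex_of_real y + \<beta>) * exp (- a * y\<^sup>2 + Re b * y)
        \<le> (norm \<alpha> + norm \<beta>) * (1 + \<bar>y\<bar>) * exp (- a * y\<^sup>2 + Re b * y)"
        by (intro mult_right_mono) auto
      then show ?thesis
        by (simp add: norm_mult E_def mult.assoc)
    qed
    show "((\<lambda>y. (\<alpha> * complex_of_real y + \<beta>) * E y) \<longlongrightarrow> 0) at_top"
      by (rule Lim_null_comparison[OF always_eventually, rule_format, OF le])
         (rule tendsto_mult_right_zero[OF gaussian_decay(1)[OF a]])
    show "((\<lambda>y. (\<alpha> * complex_of_real y + \<beta>) * E y) \<longlongrightarrow> 0) at_bot"
      by (rule Lim_null_comparison[OF always_eventually, rule_format, OF le])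
         (rule tendsto_mult_right_zero[OF gaussian_decay(2)[OF a]])
  qed
  then have "(LINT y|lborel. complex_of_real (1 + y\<^sup>2) * E y) = (1 + \<gamma>) * (LINT y|lborel. E y)"
    using int1 int0 by simp
  then show ?thesis
    using gaussian_integral[OF a, of b] by (simp add: E_def \<gamma>_def)
qed

subsection \<open>The Mehler kernel and its Fourier transform\<close>

definition mehler :: "real \<Rightarrow> real \<Rightarrow> real \<Rightarrow> real" where
  "mehler t x y = sqrt 2 / sqrt (1 - t\<^sup>2) *
     exp (- pi * ((1 + t\<^sup>2) * (x\<^sup>2 + y\<^sup>2) - 4 * t * x * y) / (1 - t\<^sup>2))"

text \<open>This is the formula of \<open>mehler\<close> at the imaginary time -i t, as expected
  from the Fourier eigenvalues (-i)^n of the Hermite functions.\<close>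

definition mehler_hat :: "real \<Rightarrow> real \<Rightarrow> real \<Rightarrow> complex" where
  "mehler_hat t x \<xi> = complex_of_real (sqrt 2 / sqrt (1 + t\<^sup>2)) *
     exp (complex_of_real (- pi * (1 - t\<^sup>2) * (x\<^sup>2 + \<xi>\<^sup>2) / (1 + t\<^sup>2))
       - \<i> * complex_of_real (4 * pi * t * x * \<xi> / (1 + t\<^sup>2)))"

lemma mehler_measurable [measurable]:
  "(\<lambda>(t, y). mehler t x y) \<in> borel_measurable (borel \<Otimes>\<^sub>M borel)"
  unfolding mehler_def by measurable

lemma mehler_hat_measurable [measurable]:
  "(\<lambda>(t, \<xi>). mehler_hat t x \<xi>) \<in> borel_measurable (borel \<Otimes>\<^sub>M borel)"
  unfolding mehler_hat_def by measurable

lemma mehler_nonneg: "mehler t x y \<ge> 0" if "\<bar>t\<bar> < 1"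
  using that by (simp add: mehler_def power_le_one_iff abs_square_le_1)

lemma fourier_mehler:
  assumes t: "0 < t" "t < 1"
  shows "fourier (\<lambda>y. complex_of_real (mehler t x y)) \<xi> = mehler_hat t x \<xi>"
proof -
  define p q where "p = 1 - t\<^sup>2" and "q = 1 + t\<^sup>2"
  have p: "p > 0" and q: "q > 0"
    using t by (auto simp: p_def q_def power_less_one_iff add_pos_nonneg)
  define a where "a = pi * q / p"
  define b where "b = Complex (4 * pi * t * x / p) (- 2 * pi * \<xi>)"
  define k where "k = sqrt 2 / sqrt p * exp (- a * x\<^sup>2)"
  have a: "a > 0" using p q by (simp add: a_def)
  have eq: "complex_of_real (mehler t x y) * exp (- (2 * complex_of_real pi * \<i> * complex_of_real \<xi> * complex_of_real y))
      = complex_of_real k * exp (complex_of_real (- a * y\<^sup>2) + b * complex_of_real y)" for y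
  proof -
    have "- pi * (q * (x\<^sup>2 + y\<^sup>2) - 4 * t * x * y) / p = - a * x\<^sup>2 + (- a * y\<^sup>2 + Re b * y)"
      using p by (simp add: a_def b_def field_simps)
    then have m: "mehler t x y = k * exp (- a * y\<^sup>2 + Re b * y)"
      unfolding mehler_def p_def[symmetric] q_def[symmetric] by (simp only: exp_add k_def mult.assoc)
    have "complex_of_real (- a * y\<^sup>2) + b * complex_of_real y
      = complex_of_real (- a * y\<^sup>2 + Re b * y) + - (2 * complex_of_real pi * \<i> * complex_of_real \<xi> * complex_of_real y)"
      by (simp add: complex_eq_iff b_def)
    then show ?thesis
      by (simp only: exp_add exp_of_real m of_real_mult mult.assoc)
  qed
  have "fourier (\<lambda>y. complex_of_real (mehler t x y)) \<xi>
    = complex_of_real (k * sqrt (pi / a)) * exp (b\<^sup>2 / (4 * complex_of_real a))"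
    unfolding fourier_def eq integral_mult_right_zero gaussian_integral[OF a] by simp
  also have "\<dots> = complex_of_real (sqrt 2 / sqrt q) * exp (complex_of_real (- a * x\<^sup>2) + b\<^sup>2 / (4 * complex_of_real a))"
  proof -
    have "sqrt 2 / sqrt p * sqrt (pi / a) = sqrt 2 / sqrt q"
      using p q by (simp add: a_def real_sqrt_divide)
    then have "k * sqrt (pi / a) = sqrt 2 / sqrt q * exp (- a * x\<^sup>2)"
      unfolding k_def by (metis mult.assoc mult.commute)
    moreover have "exp (complex_of_real (- a * x\<^sup>2) + b\<^sup>2 / (4 * complex_of_real a))
      = complex_of_real (exp (- a * x\<^sup>2)) * exp (b\<^sup>2 / (4 * complex_of_real a))"
      by (simp only: exp_add exp_of_real)
    ultimately show ?thesis by (simp only: of_real_mult mult.assoc)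
  qed
  also have "complex_of_real (- a * x\<^sup>2) + b\<^sup>2 / (4 * complex_of_real a)
    = complex_of_real (- pi * p * (x\<^sup>2 + \<xi>\<^sup>2) / q) - \<i> * complex_of_real (4 * pi * t * x * \<xi> / q)"
  proof -
    \<comment> \<open>This identity collapses the coefficient of x^2 in the exponent; p and q end up
      with their roles exchanged.\<close>
    have "q\<^sup>2 - 4 * t\<^sup>2 = p\<^sup>2" by (simp add: p_def q_def power2_eq_square algebra_simps)
    then have pq: "4 * t\<^sup>2 = q\<^sup>2 - p\<^sup>2" by simp
    have b2: "b\<^sup>2 = Complex (pi\<^sup>2 * (4 * (4 * t\<^sup>2) * x\<^sup>2 / p\<^sup>2 - 4 * \<xi>\<^sup>2)) (- 16 * pi\<^sup>2 * t * x * \<xi> / p)"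
      by (simp add: b_def complex_eq_iff power2_eq_square algebra_simps)
    have "Re (b\<^sup>2 / (4 * complex_of_real a)) = Re (b\<^sup>2) / (4 * a)" "Im (b\<^sup>2 / (4 * complex_of_real a)) = Im (b\<^sup>2) / (4 * a)"
      using Re_divide_of_real[of "b\<^sup>2" "4 * a"] Im_divide_of_real[of "b\<^sup>2" "4 * a"] by simp_all
    then have "Re (b\<^sup>2 / (4 * complex_of_real a)) = pi\<^sup>2 * (4 * (q\<^sup>2 - p\<^sup>2) * x\<^sup>2 / p\<^sup>2 - 4 * \<xi>\<^sup>2) / (4 * a)"
      "Im (b\<^sup>2 / (4 * complex_of_real a)) = (- 16 * pi\<^sup>2 * t * x * \<xi> / p) / (4 * a)"
      unfolding b2 pq by simp_all
    then have "Re (b\<^sup>2 / (4 * complex_of_real a)) - a * x\<^sup>2 = - pi * p * (x\<^sup>2 + \<xi>\<^sup>2) / q"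
      "Im (b\<^sup>2 / (4 * complex_of_real a)) = - (4 * pi * t * x * \<xi> / q)"
      using p q by (simp_all add: a_def power2_eq_square divide_simps) (simp_all add: algebra_simps)
    then show ?thesis
      by (auto simp add: complex_eq_iff)
  qed
  finally show ?thesis
    by (simp only: mehler_hat_def p_def q_def)
qed

text \<open>\<open>mehler_symbol\<close> is the factor by which \<open>1 - \<partial>\<^sub>y\<^sup>2/4\<pi>\<^sup>2\<close> multiplies \<open>mehler t x y\<close>.\<close>

definition mehler_symbol :: "real \<Rightarrow> real \<Rightarrow> real \<Rightarrow> real" where
  "mehler_symbol t x y = 1 + (1 + t\<^sup>2) / (2 * pi * (1 - t\<^sup>2))
     - (((1 + t\<^sup>2) * y - 2 * t * x) / (1 - t\<^sup>2))\<^sup>2"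

text \<open>Fourier inversion for one explicit Gaussian. Because \<open>mehler\<close> is real, the
  conjugate together with the forward exponential gives the inverse transform, and the weight 1 +
  \<xi>^2 turns into 1 - D^2/(4 pi^2). The result is read off the second moment, without
  differentiating under the integral.\<close>

lemma mehler_hat_inversion:
  assumes t: "0 < t" "t < 1"
  shows "(LINT \<xi>|lborel. complex_of_real (1 + \<xi>\<^sup>2) * (cnj (mehler_hat t x \<xi>)
      * exp (- (2 * complex_of_real pi * \<i> * complex_of_real \<xi> * complex_of_real y))))
    = complex_of_real (mehler_symbol t x y * mehler t x y)"
proof -
  define p q where "p = 1 - t\<^sup>2" and "q = 1 + t\<^sup>2"
  have p: "p > 0" and q: "q > 0"
    using t by (auto simp: p_def q_def power_less_one_iff add_pos_nonneg)
  define a where "a = pi * p / q"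
  \<comment> \<open>The phase of the conjugated \<open>mehler_hat\<close> and that of the Fourier
    exponential combine to exp(i s \<xi>). The Gaussian formulas are applied with b = i s, which is
    where the minus signs before s^2 come from.\<close>
  define s where "s = 2 * pi * (2 * t * x / q - y)"
  define k where "k = sqrt 2 / sqrt q * exp (- a * x\<^sup>2)"
  have a: "a > 0" using p q by (simp add: a_def)
  have eq: "cnj (mehler_hat t x \<xi>) * exp (- (2 * complex_of_real pi * \<i> * complex_of_real \<xi> * complex_of_real y))
      = complex_of_real k * exp (complex_of_real (- a * \<xi>\<^sup>2) + \<i> * complex_of_real s * complex_of_real \<xi>)" for \<xi>
  proof -
    have "- pi * p * (x\<^sup>2 + \<xi>\<^sup>2) / q = - a * x\<^sup>2 + - a * \<xi>\<^sup>2"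
      using q by (simp add: a_def field_simps)
    moreover have cnj: "cnj (complex_of_real c * exp (complex_of_real u - \<i> * complex_of_real v))
        = complex_of_real c * exp (complex_of_real u + \<i> * complex_of_real v)" for c u v :: real
      by (simp add: exp_cnj)
    have "exp (complex_of_real (- a * x\<^sup>2 + - a * \<xi>\<^sup>2) + z)
        = complex_of_real (exp (- a * x\<^sup>2)) * exp (complex_of_real (- a * \<xi>\<^sup>2) + z)" for z
      by (simp only: exp_of_real[symmetric] exp_add[symmetric] of_real_add add.assoc)
    ultimately have m: "cnj (mehler_hat t x \<xi>) = complex_of_real k * exp (complex_of_real (- a * \<xi>\<^sup>2) + \<i> * complex_of_real (4 * pi * t * x * \<xi> / q))"
      unfolding mehler_hat_def p_def[symmetric] q_def[symmetric] cnj k_def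
      by (simp only: of_real_mult mult.assoc)
    have "complex_of_real (- a * \<xi>\<^sup>2) + \<i> * complex_of_real s * complex_of_real \<xi>
      = complex_of_real (- a * \<xi>\<^sup>2) + \<i> * complex_of_real (4 * pi * t * x * \<xi> / q)
        + - (2 * complex_of_real pi * \<i> * complex_of_real \<xi> * complex_of_real y)"
      by (simp add: complex_eq_iff s_def algebra_simps)
    then show ?thesis
      by (simp only: exp_add m mult.assoc)
  qed
  have "(LINT \<xi>|lborel. complex_of_real (1 + \<xi>\<^sup>2) * (cnj (mehler_hat t x \<xi>)
      * exp (- (2 * complex_of_real pi * \<i> * complex_of_real \<xi> * complex_of_real y))))
    = complex_of_real k * (LINT \<xi>|lborel. complex_of_real (1 + \<xi>\<^sup>2) * exp (complex_of_real (- a * \<xi>\<^sup>2) + \<i> * complex_of_real s * complex_of_real \<xi>))"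
    unfolding eq by (subst integral_mult_right_zero[symmetric], rule Bochner_Integration.integral_cong) (auto simp: mult_ac)
  also have "\<dots> = complex_of_real (k * ((1 + 1 / (2 * a) - s\<^sup>2 / (4 * a\<^sup>2)) * (sqrt (pi / a) * exp (- s\<^sup>2 / (4 * a)))))"
    unfolding gaussian_second_moment[OF a]
    by (simp add: power_mult_distrib exp_of_real[symmetric] del: exp_of_real)
  also have "1 + 1 / (2 * a) - s\<^sup>2 / (4 * a\<^sup>2) = 1 + q / (2 * pi * p) - ((q * y - 2 * t * x) / p)\<^sup>2"
  proof -
    have "s / (2 * a) = - ((q * y - 2 * t * x) / p)"
      using p q by (simp add: s_def a_def field_simps)
    then have "(s / (2 * a))\<^sup>2 = ((q * y - 2 * t * x) / p)\<^sup>2"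
      by (simp only: power2_minus)
    moreover have "(s / (2 * a))\<^sup>2 = s\<^sup>2 / (4 * a\<^sup>2)"
      by (simp add: power_divide power_mult_distrib)
    ultimately show ?thesis
      by (simp add: a_def)
  qed
  also have "k * ((1 + q / (2 * pi * p) - ((q * y - 2 * t * x) / p)\<^sup>2) * (sqrt (pi / a) * exp (- s\<^sup>2 / (4 * a))))
     = (1 + q / (2 * pi * p) - ((q * y - 2 * t * x) / p)\<^sup>2) * mehler t x y"
  proof -
    have "q\<^sup>2 - 4 * t\<^sup>2 = p\<^sup>2" by (simp add: p_def q_def power2_eq_square algebra_simps)
    then have pq: "4 * t\<^sup>2 = q\<^sup>2 - p\<^sup>2" by simp
    have "s\<^sup>2 / (4 * a) = pi * (q * y - 2 * t * x)\<^sup>2 / (p * q)"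
      using p q by (simp add: s_def a_def power2_eq_square divide_simps) (simp add: algebra_simps)
    moreover have "(q * y - 2 * t * x)\<^sup>2 = q * (q * y\<^sup>2 - 4 * t * x * y) + (4 * t\<^sup>2) * x\<^sup>2"
      by (simp add: power2_eq_square algebra_simps)
    moreover have "a * x\<^sup>2 + pi * (q * (q * y\<^sup>2 - 4 * t * x * y) + (q\<^sup>2 - p\<^sup>2) * x\<^sup>2) / (p * q)
       = pi * (q * (x\<^sup>2 + y\<^sup>2) - 4 * t * x * y) / p"
      using p q by (simp add: a_def power2_eq_square divide_simps) (simp add: algebra_simps)
    ultimately have "- a * x\<^sup>2 + - s\<^sup>2 / (4 * a) = - pi * (q * (x\<^sup>2 + y\<^sup>2) - 4 * t * x * y) / p"
      unfolding pq by (simp add: minus_divide_left[symmetric])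
    then have "exp (- a * x\<^sup>2) * exp (- s\<^sup>2 / (4 * a)) = exp (- pi * (q * (x\<^sup>2 + y\<^sup>2) - 4 * t * x * y) / p)"
      by (simp only: exp_add[symmetric])
    moreover have "sqrt 2 / sqrt q * sqrt (pi / a) = sqrt 2 / sqrt p"
      using p q by (simp add: a_def real_sqrt_divide)
    moreover have "k * (sqrt (pi / a) * exp (- s\<^sup>2 / (4 * a)))
        = (sqrt 2 / sqrt q * sqrt (pi / a)) * (exp (- a * x\<^sup>2) * exp (- s\<^sup>2 / (4 * a)))"
      by (simp add: k_def)
    ultimately have "k * (sqrt (pi / a) * exp (- s\<^sup>2 / (4 * a))) = mehler t x y"
      unfolding mehler_def p_def[symmetric] q_def[symmetric] by simp
    then show ?thesis by (simp add: mult_ac)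
  qed
  finally show ?thesis
    by (simp only: p_def q_def mehler_symbol_def)
qed

section \<open>Pointwise bounds for the Mehler kernel\<close>

text \<open>Twice the quadratic form in the exponent equals (1 - t)^2 (x + y)^2 + (1 + t)^2 (x -
  y)^2. Dropping the first square leaves a Gaussian in x - y that sharpens as t tends to 1.\<close>

lemma mehler_le_exp:
  assumes t: "0 < t" "t < 1"
  shows "mehler t x y \<le> sqrt 2 / sqrt (1 - t\<^sup>2) * exp (- (pi / 2) * ((1 + t) / (1 - t) * (x - y)\<^sup>2))"
proof -
  have p: "1 - t\<^sup>2 > 0" using t by (simp add: power_less_one_iff)
  have "(1 + t) / (1 - t) = (1 + t)\<^sup>2 / (1 - t\<^sup>2)"
    using t p by (simp add: frac_eq_eq power2_eq_square algebra_simps)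
  then have "(1 + t) / (1 - t) * (x - y)\<^sup>2 / 2 = ((1 + t)\<^sup>2 * (x - y)\<^sup>2 / 2) / (1 - t\<^sup>2)"
    by simp
  also have "\<dots> \<le> ((1 + t\<^sup>2) * (x\<^sup>2 + y\<^sup>2) - 4 * t * x * y) / (1 - t\<^sup>2)"
  proof (rule divide_right_mono)
    have "2 * ((1 + t\<^sup>2) * (x\<^sup>2 + y\<^sup>2) - 4 * t * x * y) = ((1 - t) * (x + y))\<^sup>2 + (1 + t)\<^sup>2 * (x - y)\<^sup>2"
      by (simp add: power2_eq_square algebra_simps)
    moreover have "v / 2 \<le> w" if "2 * w = u + v" "0 \<le> u" for u v w :: real
      using that by simp
    ultimately show "(1 + t)\<^sup>2 * (x - y)\<^sup>2 / 2 \<le> (1 + t\<^sup>2) * (x\<^sup>2 + y\<^sup>2) - 4 * t * x * y"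
      by (metis zero_le_power2)
  qed (use p in simp)
  finally have "pi * ((1 + t) / (1 - t) * (x - y)\<^sup>2 / 2) \<le> pi * (((1 + t\<^sup>2) * (x\<^sup>2 + y\<^sup>2) - 4 * t * x * y) / (1 - t\<^sup>2))"
    by (intro mult_left_mono) auto
  moreover have "- pi * u / v = - (pi * (u / v))" "- (pi / 2) * u = - (pi * (u / 2))" for u v :: real
    by simp_all
  ultimately show ?thesis
    unfolding mehler_def using p by (intro mult_left_mono) (simp_all only: exp_le_cancel_iff neg_le_iff_le, simp)
qed

text \<open>The form used for domination: the factors in t and in y are separated, and the
  singularity at t = 1 is integrable.\<close>

lemma mehler_le:
  assumes t: "0 < t" "t < 1"
  shows "mehler t x y \<le> sqrt 2 / sqrt (1 - t) * exp (- (pi / 2) * (x - y)\<^sup>2)"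
proof -
  have "1 - t \<le> 1 - t\<^sup>2" using t by (simp add: power2_eq_square mult_left_le)
  moreover have "1 * (x - y)\<^sup>2 \<le> (1 + t) / (1 - t) * (x - y)\<^sup>2"
    using t by (intro mult_right_mono) (auto simp: field_simps)
  then have "(pi / 2) * (1 * (x - y)\<^sup>2) \<le> (pi / 2) * ((1 + t) / (1 - t) * (x - y)\<^sup>2)"
    by (intro mult_left_mono) auto
  then have "exp (- (pi / 2) * ((1 + t) / (1 - t) * (x - y)\<^sup>2)) \<le> exp (- (pi / 2) * (x - y)\<^sup>2)"
    by (simp only: exp_le_cancel_iff mult_minus_left neg_le_iff_le mult_1)
  ultimately show ?thesis
    using t by (intro order.trans[OF mehler_le_exp[OF t]] mult_mono divide_left_mono) auto
qed

text \<open>Split (1 + t)/(1 - t) = 1 + 2t/(1 - t). The summand 1 keeps an integrable Gaussian in y,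
  while the other one, with \<delta>^2 in place of (x - y)^2, gives a factor that vanishes as t
  tends to 1.\<close>

lemma mehler_le_away:
  assumes t: "0 < t" "t < 1" and d: "0 \<le> \<delta>" "\<delta> \<le> \<bar>x - y\<bar>"
  shows "mehler t x y \<le> sqrt 2 / sqrt (1 - t\<^sup>2) * exp (- pi * \<delta>\<^sup>2 * t / (1 - t)) * exp (- (pi / 2) * (x - y)\<^sup>2)"
proof -
  have p: "1 - t\<^sup>2 > 0" using t by (simp add: power_less_one_iff)
  have "\<delta>\<^sup>2 \<le> (x - y)\<^sup>2" using d by (simp add: abs_le_square_iff[symmetric])
  then have "2 * t / (1 - t) * \<delta>\<^sup>2 \<le> 2 * t / (1 - t) * (x - y)\<^sup>2"
    using t by (intro mult_left_mono) auto
  moreover have "(1 + t) / (1 - t) = 1 + 2 * t / (1 - t)" using t by (simp add: field_simps)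
  ultimately have "(x - y)\<^sup>2 + 2 * t / (1 - t) * \<delta>\<^sup>2 \<le> (1 + t) / (1 - t) * (x - y)\<^sup>2"
    by (simp add: distrib_right)
  then have "(pi / 2) * ((x - y)\<^sup>2 + 2 * t / (1 - t) * \<delta>\<^sup>2) \<le> (pi / 2) * ((1 + t) / (1 - t) * (x - y)\<^sup>2)"
    by (intro mult_left_mono) auto
  moreover have "(pi / 2) * ((x - y)\<^sup>2 + 2 * t / (1 - t) * \<delta>\<^sup>2) = - (- pi * \<delta>\<^sup>2 * t / (1 - t) + - (pi / 2) * (x - y)\<^sup>2)"
    by (simp add: distrib_left)
  ultimately have "- (pi / 2) * ((1 + t) / (1 - t) * (x - y)\<^sup>2) \<le> - pi * \<delta>\<^sup>2 * t / (1 - t) + - (pi / 2) * (x - y)\<^sup>2"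
    by (simp only: mult_minus_left)
  then have "exp (- (pi / 2) * ((1 + t) / (1 - t) * (x - y)\<^sup>2)) \<le> exp (- pi * \<delta>\<^sup>2 * t / (1 - t)) * exp (- (pi / 2) * (x - y)\<^sup>2)"
    by (simp only: exp_add[symmetric] exp_le_cancel_iff)
  then have "sqrt 2 / sqrt (1 - t\<^sup>2) * exp (- (pi / 2) * ((1 + t) / (1 - t) * (x - y)\<^sup>2))
    \<le> sqrt 2 / sqrt (1 - t\<^sup>2) * (exp (- pi * \<delta>\<^sup>2 * t / (1 - t)) * exp (- (pi / 2) * (x - y)\<^sup>2))"
    using p by (intro mult_left_mono) auto
  with mehler_le_exp[OF t, of x y] show ?thesis by (simp add: mult.assoc)
qed

lemma one_plus_square_gaussian_le:
  fixes x y :: real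
  shows "(1 + y\<^sup>2) * exp (- (pi / 2) * (x - y)\<^sup>2) \<le> 3 + 2 * x\<^sup>2"
proof -
  define u where "u = (x - y)\<^sup>2"
  have u: "u \<ge> 0" by (simp add: u_def)
  \<comment> \<open>Parallelogram law for x and x - y. With u exp(-u) at most 1, this gives the
    constant (1 + 2 x^2) + 2.\<close>
  have "y\<^sup>2 + (x + (x - y))\<^sup>2 = 2 * x\<^sup>2 + 2 * u"
    by (simp add: u_def power2_eq_square algebra_simps)
  then have y: "1 + y\<^sup>2 \<le> 1 + 2 * x\<^sup>2 + 2 * u"
    using zero_le_power2[of "x + (x - y)"] by linarith
  have "u \<le> exp u" using exp_ge_add_one_self[of u] by linarith
  then have "u * exp (- u) \<le> 1" by (simp add: exp_minus field_simps)
  moreover have e: "exp (- (pi / 2) * u) \<le> exp (- u)"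
    using u pi_gt3 by (simp add: mult_right_mono[of 1 "pi / 2" u, simplified])
  ultimately have "u * exp (- (pi / 2) * u) \<le> 1"
    using u by (meson mult_left_mono order.trans)
  moreover have "exp (- (pi / 2) * u) \<le> 1" using u by simp
  then have "(1 + 2 * x\<^sup>2) * exp (- (pi / 2) * u) \<le> 1 + 2 * x\<^sup>2"
    by (intro mult_left_le) auto
  moreover have "(1 + y\<^sup>2) * exp (- (pi / 2) * u) \<le> (1 + 2 * x\<^sup>2 + 2 * u) * exp (- (pi / 2) * u)"
    using y by (intro mult_right_mono) auto
  ultimately show ?thesis
    by (simp add: u_def[symmetric] algebra_simps)
qed

section \<open>The evolution equation in t\<close>

text \<open>On the n-th Hermite term the left side differentiates to (n + 2 pi + 1/2) t^(n + 2 pi -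
  1/2), and n + 2 pi + 1/2 is pi times the eigenvalue of 2 + y^2 - D^2/(4 pi^2). This fixes the
  exponent 2 pi + 1/2. The identity is checked here on the closed form.\<close>

lemma DERIV_mehler:
  assumes t: "0 < t" "t < 1"
  shows "((\<lambda>t. t powr (2 * pi + 1 / 2) * mehler t x y) has_real_derivative
    pi * t powr (2 * pi - 1 / 2) * (1 + y\<^sup>2 + mehler_symbol t x y) * mehler t x y) (at t)"
proof -
  define p where "p = 1 - t\<^sup>2"
  have p: "p > 0" using t by (simp add: p_def power_less_one_iff)
  define h' where "h' = - pi * (4 * t * (x\<^sup>2 + y\<^sup>2) - 4 * (1 + t\<^sup>2) * x * y) / p\<^sup>2"
  have "((\<lambda>t. - pi * ((1 + t\<^sup>2) * (x\<^sup>2 + y\<^sup>2) - 4 * t * x * y) / (1 - t\<^sup>2)) has_real_derivative h') (at t)"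
    using p unfolding h'_def p_def
    by (auto intro!: derivative_eq_intros simp: divide_simps) (simp add: power2_eq_square algebra_simps)
  from DERIV_fun_exp[OF this]
  have e: "((\<lambda>t. exp (- pi * ((1 + t\<^sup>2) * (x\<^sup>2 + y\<^sup>2) - 4 * t * x * y) / (1 - t\<^sup>2))) has_real_derivative
     exp (- pi * ((1 + t\<^sup>2) * (x\<^sup>2 + y\<^sup>2) - 4 * t * x * y) / (1 - t\<^sup>2)) * h') (at t)" .
  have s: "((\<lambda>t. sqrt 2 / sqrt (1 - t\<^sup>2)) has_real_derivative (sqrt 2 / sqrt (1 - t\<^sup>2)) * (t / p)) (at t)"
    using p unfolding p_def
    by (auto intro!: derivative_eq_intros simp: divide_simps)
  have aux: "r * u * v + v * w * r = r * v * (u + w)" for r u v w :: real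
    by (simp add: algebra_simps)
  have m: "((\<lambda>t. mehler t x y) has_real_derivative mehler t x y * (t / p + h')) (at t)"
    unfolding mehler_def by (rule DERIV_cong[OF DERIV_mult[OF s e] aux])
  have w: "((\<lambda>t. t powr (2 * pi + 1 / 2)) has_real_derivative (2 * pi + 1 / 2) * t powr (2 * pi - 1 / 2)) (at t)"
    using has_real_derivative_powr[OF t(1), of "2 * pi + 1 / 2"] by simp
  have "t powr (2 * pi + 1 / 2) = t powr (1 + (2 * pi - 1 / 2))" by (simp add: add.commute)
  also have "\<dots> = t * t powr (2 * pi - 1 / 2)"
    using t by (simp only: powr_add) simp
  finally have tp: "t powr (2 * pi + 1 / 2) = t * t powr (2 * pi - 1 / 2)" .
  have alg: "2 * pi + 1 / 2 + t * (t / p + h') = pi * (1 + y\<^sup>2 + mehler_symbol t x y)"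
  proof -
    \<comment> \<open>Over the common denominator p^2, the terms without pi and the coefficient of
      pi vanish separately.\<close>
    have "2 * pi + 1 / 2 + t * (t / p + h') - pi * (1 + y\<^sup>2 + mehler_symbol t x y)
       = ((p\<^sup>2 + 2 * t\<^sup>2 * p - (1 + t\<^sup>2) * p) / 2
          + pi * (((1 + t\<^sup>2) * y - 2 * t * x)\<^sup>2 - p\<^sup>2 * y\<^sup>2 - t * (4 * t * (x\<^sup>2 + y\<^sup>2) - 4 * (1 + t\<^sup>2) * x * y))) / p\<^sup>2"
      using p unfolding h'_def mehler_symbol_def p_def[symmetric]
      by (simp add: power_divide divide_simps) (simp add: power2_eq_square algebra_simps)
    also have "p\<^sup>2 + 2 * t\<^sup>2 * p - (1 + t\<^sup>2) * p = 0"
      by (simp add: p_def power2_eq_square algebra_simps)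
    also have "((1 + t\<^sup>2) * y - 2 * t * x)\<^sup>2 - p\<^sup>2 * y\<^sup>2 - t * (4 * t * (x\<^sup>2 + y\<^sup>2) - 4 * (1 + t\<^sup>2) * x * y) = 0"
      by (simp add: p_def power2_eq_square algebra_simps)
    finally show ?thesis by simp
  qed
  have "(2 * pi + 1 / 2) * t powr (2 * pi - 1 / 2) * mehler t x y + mehler t x y * (t / p + h') * t powr (2 * pi + 1 / 2)
    = t powr (2 * pi - 1 / 2) * mehler t x y * (2 * pi + 1 / 2 + t * (t / p + h'))"
    unfolding tp by (simp add: algebra_simps)
  also have "\<dots> = pi * t powr (2 * pi - 1 / 2) * (1 + y\<^sup>2 + mehler_symbol t x y) * mehler t x y"
    unfolding alg by (simp add: mult_ac)
  finally show ?thesis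
    using DERIV_mult[OF w m] by simp
qed

lemma isCont_mehler: "isCont (\<lambda>t. mehler t x y) t" if "\<bar>t\<bar> < 1"
  using that abs_square_less_1[of t] unfolding mehler_def by (intro continuous_intros) auto

lemma isCont_mehler_symbol: "isCont (\<lambda>t. mehler_symbol t x y) t" if "\<bar>t\<bar> < 1"
  using that abs_square_less_1[of t] unfolding mehler_symbol_def by (intro continuous_intros) auto

text \<open>Uniform in y and in t up to b, which is what an exchange of integrals over [a,b] and y
  needs. The constant blows up as b tends to 1.\<close>

lemma mehler_symbol_bound:
  assumes t: "0 < t" "t \<le> b" "b < 1"
  shows "\<bar>(1 + y\<^sup>2 + mehler_symbol t x y) * mehler t x y\<bar>
    \<le> (2 + 1 / (1 - b) + 8 * (1 + x\<^sup>2) / (1 - b)\<^sup>2) * (sqrt 2 / sqrt (1 - b) * (3 + 2 * x\<^sup>2))"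
proof -
  define d where "d = 1 - b"
  have d: "d > 0" and dt: "d \<le> 1 - t" using t by (auto simp: d_def)
  have "1 - t \<le> 1 - t\<^sup>2" using t by (simp add: power2_eq_square mult_left_le)
  then have dp: "d \<le> 1 - t\<^sup>2" using dt by simp
  have t2: "t\<^sup>2 \<le> 1" using dp d by linarith
  have "\<bar>(1 + t\<^sup>2) / (2 * pi * (1 - t\<^sup>2))\<bar> \<le> 1 / d"
  proof -
    have "(1 + t\<^sup>2) / (2 * pi * (1 - t\<^sup>2)) \<le> 2 / (2 * (1 - t\<^sup>2))"
      using d dp t2 pi_gt3 mult_right_mono[of 2 "2 * pi" "1 - t\<^sup>2"] by (intro frac_le) auto
    also have "\<dots> \<le> 1 / d" using d dp by (simp add: field_simps)
    finally show ?thesis using d dp by simp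
  qed
  moreover have "(((1 + t\<^sup>2) * y - 2 * t * x) / (1 - t\<^sup>2))\<^sup>2 \<le> 8 * (y\<^sup>2 + x\<^sup>2) / d\<^sup>2"
  proof -
    \<comment> \<open>Adding the square with the opposite sign removes the mixed term in x
      y.\<close>
    have "((1 + t\<^sup>2) * y - 2 * t * x)\<^sup>2 + ((1 + t\<^sup>2) * y + 2 * t * x)\<^sup>2 = 2 * ((1 + t\<^sup>2)\<^sup>2 * y\<^sup>2) + 8 * (t\<^sup>2 * x\<^sup>2)"
      by (simp add: power2_eq_square algebra_simps)
    moreover have "(1 + t\<^sup>2)\<^sup>2 * y\<^sup>2 \<le> 2\<^sup>2 * y\<^sup>2"
      using t2 by (intro mult_right_mono power_mono) auto
    moreover have "t\<^sup>2 * x\<^sup>2 \<le> 1 * x\<^sup>2"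
      using t2 by (intro mult_right_mono) auto
    moreover have "u \<le> 8 * (c + d)" if "u + v = 2 * a + 8 * b" "0 \<le> v" "a \<le> 2\<^sup>2 * c" "b \<le> 1 * d" for a b c d u v :: real
      using that by simp
    ultimately have "((1 + t\<^sup>2) * y - 2 * t * x)\<^sup>2 \<le> 8 * (y\<^sup>2 + x\<^sup>2)"
      by (metis zero_le_power2)
    then show ?thesis
      unfolding power_divide using d dp by (intro frac_le power_mono) auto
  qed
  ultimately have "\<bar>1 + y\<^sup>2 + mehler_symbol t x y\<bar> \<le> 2 + y\<^sup>2 + 1 / d + 8 * (y\<^sup>2 + x\<^sup>2) / d\<^sup>2"
    unfolding mehler_symbol_def
    using zero_le_power2[of "((1 + t\<^sup>2) * y - 2 * t * x) / (1 - t\<^sup>2)"] zero_le_power2[of y] by linarith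
  also have "\<dots> \<le> (2 + 1 / d + 8 * (1 + x\<^sup>2) / d\<^sup>2) * (1 + y\<^sup>2)"
  proof -
    have "0 \<le> y\<^sup>2 + y\<^sup>2 / d + 8 * (1 + x\<^sup>2 * y\<^sup>2) / d\<^sup>2" using d by simp
    then show ?thesis by (simp add: distrib_left distrib_right add_divide_distrib)
  qed
  finally have 1: "\<bar>1 + y\<^sup>2 + mehler_symbol t x y\<bar> \<le> (2 + 1 / d + 8 * (1 + x\<^sup>2) / d\<^sup>2) * (1 + y\<^sup>2)" .
  have "mehler t x y \<le> sqrt 2 / sqrt (1 - t) * exp (- (pi / 2) * (x - y)\<^sup>2)"
    using t by (intro mehler_le) auto
  also have "\<dots> \<le> sqrt 2 / sqrt d * exp (- (pi / 2) * (x - y)\<^sup>2)"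
    using d dt by (intro mult_right_mono divide_left_mono) auto
  finally have 2: "mehler t x y \<le> sqrt 2 / sqrt d * exp (- (pi / 2) * (x - y)\<^sup>2)" .
  have "\<bar>(1 + y\<^sup>2 + mehler_symbol t x y) * mehler t x y\<bar> = \<bar>1 + y\<^sup>2 + mehler_symbol t x y\<bar> * mehler t x y"
    using t by (simp add: abs_mult mehler_nonneg)
  also have "\<dots> \<le> ((2 + 1 / d + 8 * (1 + x\<^sup>2) / d\<^sup>2) * (1 + y\<^sup>2)) * (sqrt 2 / sqrt d * exp (- (pi / 2) * (x - y)\<^sup>2))"
    using 1 2 d t by (intro mult_mono) (auto simp: mehler_nonneg)
  also have "\<dots> = (2 + 1 / d + 8 * (1 + x\<^sup>2) / d\<^sup>2) * (sqrt 2 / sqrt d * ((1 + y\<^sup>2) * exp (- (pi / 2) * (x - y)\<^sup>2)))"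
    by (simp only: mult_ac)
  also have "\<dots> \<le> (2 + 1 / d + 8 * (1 + x\<^sup>2) / d\<^sup>2) * (sqrt 2 / sqrt d * (3 + 2 * x\<^sup>2))"
    using d by (intro mult_left_mono one_plus_square_gaussian_le) auto
  finally show ?thesis unfolding d_def .
qed

subsection \<open>The time evolution of a function under the Mehler kernel\<close>

lemma cnj_measurable [measurable]: "cnj \<in> borel_measurable borel"
  by (intro borel_measurable_continuous_onI continuous_intros)

text \<open>The exponent is weakened to one linear in 1 - t, by (1 - t^2)/(1 + t^2) being at least 1
  - t, so that its integral over t can be evaluated exactly.\<close>

lemma norm_mehler_hat_le:
  assumes t: "0 < t" "t < 1"
  shows "norm (mehler_hat t x \<xi>) \<le> sqrt 2 * exp (- (pi * (1 - t)) * \<xi>\<^sup>2)"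
proof -
  have t2: "t\<^sup>2 < 1" using t by (simp add: power_less_one_iff)
  have t3: "t\<^sup>2 \<le> t" using t by (simp add: power2_eq_square mult_left_le)
  have Re: "Re (complex_of_real u - \<i> * complex_of_real v) = u" for u v by simp
  have "norm (mehler_hat t x \<xi>) = \<bar>sqrt 2 / sqrt (1 + t\<^sup>2)\<bar> * exp (- pi * (1 - t\<^sup>2) * (x\<^sup>2 + \<xi>\<^sup>2) / (1 + t\<^sup>2))"
    by (simp only: mehler_hat_def norm_mult norm_of_real norm_exp_eq_Re Re)
  also have "\<dots> = sqrt 2 / sqrt (1 + t\<^sup>2) * exp (- pi * (1 - t\<^sup>2) * (x\<^sup>2 + \<xi>\<^sup>2) / (1 + t\<^sup>2))"
    by simp
  also have "\<dots> \<le> sqrt 2 * exp (- (pi * (1 - t)) * \<xi>\<^sup>2)"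
  proof (intro mult_mono)
    have "sqrt 2 / sqrt (1 + t\<^sup>2) \<le> sqrt 2 / 1" by (intro divide_left_mono) (auto simp: add_pos_nonneg)
    then show "sqrt 2 / sqrt (1 + t\<^sup>2) \<le> sqrt 2" by simp
    have "(1 - t) * (1 + t\<^sup>2) \<le> (1 - t) * (1 + t)"
      using t t3 by (intro mult_left_mono) auto
    then have "1 - t \<le> (1 - t\<^sup>2) / (1 + t\<^sup>2)"
      using t2 by (subst pos_le_divide_eq) (auto simp: add_pos_nonneg power2_eq_square algebra_simps)
    then have "pi * ((1 - t) * \<xi>\<^sup>2) \<le> pi * ((1 - t\<^sup>2) / (1 + t\<^sup>2) * (x\<^sup>2 + \<xi>\<^sup>2))"
      using t2 by (intro mult_left_mono mult_mono) (auto simp: add_nonneg_nonneg)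
    then show "exp (- pi * (1 - t\<^sup>2) * (x\<^sup>2 + \<xi>\<^sup>2) / (1 + t\<^sup>2)) \<le> exp (- (pi * (1 - t)) * \<xi>\<^sup>2)"
      by (simp add: mult.assoc)
  qed auto
  finally show ?thesis .
qed

lemma integrable_weighted_mehler_hat:
  assumes t: "0 < t" "t < 1"
  shows "integrable lborel (\<lambda>\<xi>. (1 + \<xi>\<^sup>2) * norm (mehler_hat t x \<xi>))"
proof (rule Bochner_Integration.integrable_bound)
  show "integrable lborel (\<lambda>\<xi>. sqrt 2 * ((1 + \<xi>\<^sup>2) * exp (- (pi * (1 - t)) * \<xi>\<^sup>2 + 0 * \<xi>)))"
    using t by (intro integrable_mult_right integrable_one_plus_square_gaussian) auto
  have "(1 + \<xi>\<^sup>2) * norm (mehler_hat t x \<xi>) \<le> sqrt 2 * ((1 + \<xi>\<^sup>2) * exp (- (pi * (1 - t)) * \<xi>\<^sup>2))" for \<xi>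
    using mult_left_mono[OF norm_mehler_hat_le[OF t], of "1 + \<xi>\<^sup>2"] by (simp add: mult.left_commute)
  then show "AE \<xi> in lborel. norm ((1 + \<xi>\<^sup>2) * norm (mehler_hat t x \<xi>))
      \<le> norm (sqrt 2 * ((1 + \<xi>\<^sup>2) * exp (- (pi * (1 - t)) * \<xi>\<^sup>2 + 0 * \<xi>)))"
    by (intro AE_I2) simp
qed measurable

text \<open>For fixed t < 1 the Gaussian decay of \<open>mehler_hat\<close> absorbs the weight, so
  integrability of f alone permits the exchange.\<close>

lemma fourier_pairing_mehler_hat:
  assumes t: "0 < t" "t < 1" and f: "integrable lborel f"
  shows "(LINT \<xi>|lborel. fourier f \<xi> * cnj (mehler_hat t x \<xi>) * complex_of_real (1 + \<xi>\<^sup>2))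
    = (LINT y|lborel. f y * complex_of_real (mehler_symbol t x y * mehler t x y))"
proof -
  define e where "e \<xi> y = exp (- (2 * complex_of_real pi * \<i> * complex_of_real \<xi> * complex_of_real y))" for \<xi> y
  define F where "F \<xi> y = f y * e \<xi> y * cnj (mehler_hat t x \<xi>) * complex_of_real (1 + \<xi>\<^sup>2)" for \<xi> y
  have [measurable]: "f \<in> borel_measurable borel" using f by simp
  have [measurable]: "(\<lambda>(\<xi>, y). e \<xi> y) \<in> borel_measurable (borel \<Otimes>\<^sub>M borel)"
    unfolding e_def by measurable
  have ne: "norm (e \<xi> y) = 1" for \<xi> y
    by (simp add: e_def)
  have nw: "norm (complex_of_real (1 + \<xi>\<^sup>2)) = 1 + \<xi>\<^sup>2" for \<xi> :: real
    by (simp only: norm_of_real) simp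
  have "integrable (lborel \<Otimes>\<^sub>M lborel) (case_prod F)"
  proof (rule integrable_product_bound)
    show "case_prod F \<in> borel_measurable (borel \<Otimes>\<^sub>M borel)"
      unfolding F_def by measurable
    show "integrable lborel (\<lambda>\<xi>. (1 + \<xi>\<^sup>2) * norm (mehler_hat t x \<xi>))"
      by (rule integrable_weighted_mehler_hat[OF t])
    show "integrable lborel (\<lambda>y. norm (f y))" using f by simp
    show "norm (F \<xi> y) \<le> (1 + \<xi>\<^sup>2) * norm (mehler_hat t x \<xi>) * norm (f y)" for \<xi> y
      by (simp only: F_def norm_mult ne nw complex_mod_cnj) simp
  qed
  from lborel_pair.Fubini_integral[OF this]
  have "(LINT \<xi>|lborel. LINT y|lborel. F \<xi> y) = (LINT y|lborel. LINT \<xi>|lborel. F \<xi> y)" by simp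
  moreover have "(LINT y|lborel. F \<xi> y) = fourier f \<xi> * cnj (mehler_hat t x \<xi>) * complex_of_real (1 + \<xi>\<^sup>2)" for \<xi>
    unfolding F_def fourier_def e_def by (simp only: integral_mult_left_zero)
  moreover have "(LINT \<xi>|lborel. F \<xi> y) = f y * complex_of_real (mehler_symbol t x y * mehler t x y)" for y
  proof -
    have "F \<xi> y = f y * (complex_of_real (1 + \<xi>\<^sup>2) * (cnj (mehler_hat t x \<xi>) * e \<xi> y))" for \<xi>
      by (simp only: F_def mult_ac)
    then show ?thesis
      using mehler_hat_inversion[OF t, of x y] unfolding e_def by (simp only: integral_mult_right_zero)
  qed
  ultimately show ?thesis by simp
qed

text \<open>The power of t is the integrating factor of the evolution equation. It also makes the
  contribution of the lower end t = 0 vanish.\<close>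

definition mehler_flow :: "(real \<Rightarrow> complex) \<Rightarrow> real \<Rightarrow> real \<Rightarrow> complex" where
  "mehler_flow f x t = complex_of_real (t powr (2 * pi + 1 / 2)) * (LINT y|lborel. f y * complex_of_real (mehler t x y))"

lemma mehler_bounded:
  assumes t: "0 < t" "t < 1"
  shows "mehler t x y \<le> sqrt 2 / sqrt (1 - t)"
proof -
  have "exp (- (pi / 2) * (x - y)\<^sup>2) \<le> 1" by simp
  then have "sqrt 2 / sqrt (1 - t) * exp (- (pi / 2) * (x - y)\<^sup>2) \<le> sqrt 2 / sqrt (1 - t) * 1"
    using t by (intro mult_left_mono) auto
  with mehler_le[OF t, of x y] show ?thesis by simp
qed

lemma integrable_mult_mehler:
  assumes t: "0 < t" "t < 1" and f: "integrable lborel f"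
  shows "integrable lborel (\<lambda>y. f y * complex_of_real (mehler t x y))"
proof (rule Bochner_Integration.integrable_bound)
  show "integrable lborel (\<lambda>y. sqrt 2 / sqrt (1 - t) * norm (f y))" using f by simp
  show "AE y in lborel. norm (f y * complex_of_real (mehler t x y)) \<le> norm (sqrt 2 / sqrt (1 - t) * norm (f y))"
    using mult_right_mono[OF mehler_bounded[OF t], of "norm (f _)"] t
    by (intro AE_I2) (simp add: norm_mult mehler_nonneg mult.commute)
  have [measurable]: "f \<in> borel_measurable borel" using f by simp
  show "(\<lambda>y. f y * complex_of_real (mehler t x y)) \<in> borel_measurable lborel" by measurable
qed

lemma mehler_symbol_measurable [measurable]:
  "(\<lambda>(t, y). mehler_symbol t x y) \<in> borel_measurable (borel \<Otimes>\<^sub>M borel)"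
  unfolding mehler_symbol_def by measurable

text \<open>Exchanging the integrals puts the t-integral inside, where the fundamental theorem
  applies for each fixed y. This avoids differentiating the y-integral with respect to t.\<close>

lemma integral_derivative_mehler_flow:
  assumes ab: "0 < a" "a \<le> b" "b < 1" and f: "integrable lborel f"
  shows "(LINT t|lborel. indicator {a..b} t *\<^sub>R (complex_of_real (pi * t powr (2 * pi - 1 / 2)) *
      (LINT y|lborel. f y * complex_of_real ((1 + y\<^sup>2 + mehler_symbol t x y) * mehler t x y))))
    = mehler_flow f x b - mehler_flow f x a"
proof -
  define V where "V t y = pi * t powr (2 * pi - 1 / 2) * (1 + y\<^sup>2 + mehler_symbol t x y) * mehler t x y" for t y
  define F where "F t y = complex_of_real (V t y * indicator {a..b} t) * f y" for t y
  define C where "C = (2 + 1 / (1 - b) + 8 * (1 + x\<^sup>2) / (1 - b)\<^sup>2) * (sqrt 2 / sqrt (1 - b) * (3 + 2 * x\<^sup>2))"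
  have [measurable]: "f \<in> borel_measurable borel" using f by simp
  have Vm [measurable]: "(\<lambda>(t, y). V t y) \<in> borel_measurable (borel \<Otimes>\<^sub>M borel)"
    unfolding V_def by measurable
  have V_le: "\<bar>V t y\<bar> \<le> pi * C" if "t \<in> {a..b}" for t y
  proof -
    have "t powr (2 * pi - 1 / 2) \<le> 1"
      using that ab pi_gt3 by (intro powr_le1) auto
    then have "pi * t powr (2 * pi - 1 / 2) * \<bar>(1 + y\<^sup>2 + mehler_symbol t x y) * mehler t x y\<bar> \<le> pi * 1 * C"
      unfolding C_def using that ab by (intro mult_mono mehler_symbol_bound) auto
    then show ?thesis by (simp add: V_def abs_mult mult.assoc)
  qed
  have "integrable (lborel \<Otimes>\<^sub>M lborel) (case_prod F)"
  proof (rule integrable_product_bound)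
    show "case_prod F \<in> borel_measurable (borel \<Otimes>\<^sub>M borel)"
      unfolding F_def by measurable
    show "integrable lborel (\<lambda>t. indicator {a..b} t * (pi * C))"
      by (intro integrable_mult_left integrable_real_indicator) (auto simp: emeasure_lborel_Icc_eq)
    show "integrable lborel (\<lambda>y. norm (f y))" using f by simp
    show "norm (F t y) \<le> indicator {a..b} t * (pi * C) * norm (f y)" for t y
      using V_le[of t y] by (auto simp: F_def norm_mult indicator_def intro!: mult_right_mono)
  qed
  from lborel_pair.Fubini_integral[OF this]
  have "(LINT t|lborel. LINT y|lborel. F t y) = (LINT y|lborel. LINT t|lborel. F t y)" by simp
  moreover have "(LINT t|lborel. F t y) = f y * complex_of_real (b powr (2 * pi + 1 / 2) * mehler b x y)
      - f y * complex_of_real (a powr (2 * pi + 1 / 2) * mehler a x y)" for y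
  proof -
    have "(LINT t|lborel. V t y * indicator {a..b} t) = b powr (2 * pi + 1 / 2) * mehler b x y - a powr (2 * pi + 1 / 2) * mehler a x y"
    proof (rule integral_FTC_Icc_real[where F = "\<lambda>t. t powr (2 * pi + 1 / 2) * mehler t x y", OF ab(2)])
      fix t assume t: "a \<le> t" "t \<le> b"
      show "((\<lambda>t. t powr (2 * pi + 1 / 2) * mehler t x y) has_real_derivative V t y) (at t)"
        unfolding V_def using t ab by (intro DERIV_mehler) auto
      have [simp]: "isCont (\<lambda>t. mehler t x y) t" "isCont (\<lambda>t. mehler_symbol t x y) t"
        using t ab by (auto intro!: isCont_mehler isCont_mehler_symbol)
      show "isCont (\<lambda>t. V t y) t"
        unfolding V_def using t ab by (intro continuous_intros) auto
    qed
    then show ?thesis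
      unfolding F_def integral_mult_left_zero integral_complex_of_real
      by (simp only: of_real_diff right_diff_distrib left_diff_distrib mult.commute)
  qed
  moreover have "(LINT y|lborel. F t y) = indicator {a..b} t *\<^sub>R (complex_of_real (pi * t powr (2 * pi - 1 / 2)) *
      (LINT y|lborel. f y * complex_of_real ((1 + y\<^sup>2 + mehler_symbol t x y) * mehler t x y)))" for t
  proof -
    have "F t y = (complex_of_real (indicator {a..b} t) * complex_of_real (pi * t powr (2 * pi - 1 / 2))) *
        (f y * complex_of_real ((1 + y\<^sup>2 + mehler_symbol t x y) * mehler t x y))" for y
      by (simp only: F_def V_def of_real_mult mult_ac)
    then show ?thesis by (simp only: integral_mult_right_zero scaleR_conv_of_real mult.assoc)
  qed
  ultimately have "(LINT t|lborel. indicator {a..b} t *\<^sub>R (complex_of_real (pi * t powr (2 * pi - 1 / 2)) *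
      (LINT y|lborel. f y * complex_of_real ((1 + y\<^sup>2 + mehler_symbol t x y) * mehler t x y))))
    = (LINT y|lborel. f y * complex_of_real (b powr (2 * pi + 1 / 2) * mehler b x y)
      - f y * complex_of_real (a powr (2 * pi + 1 / 2) * mehler a x y))"
    by simp
  also have "\<dots> = (LINT y|lborel. complex_of_real (b powr (2 * pi + 1 / 2)) * (f y * complex_of_real (mehler b x y))
      - complex_of_real (a powr (2 * pi + 1 / 2)) * (f y * complex_of_real (mehler a x y)))"
    by (simp only: of_real_mult mult_ac)
  also have "\<dots> = mehler_flow f x b - mehler_flow f x a"
    unfolding mehler_flow_def using ab f
    by (subst Bochner_Integration.integral_diff) (auto intro!: integrable_mult_right integrable_mult_mehler)
  finally show ?thesis .
qed

section \<open>Limits of the flow at t = 0 and t = 1\<close>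

lemma mehler_flow_at_0:
  assumes f: "integrable lborel f"
  shows "(mehler_flow f x \<longlongrightarrow> 0) (at_right 0)"
proof (rule Lim_null_comparison)
  define N where "N = (LINT y|lborel. norm (f y))"
  show "\<forall>\<^sub>F t in at_right 0. norm (mehler_flow f x t) \<le> t powr (2 * pi + 1 / 2) * (sqrt 2 / sqrt (1 - t) * N)"
  proof (rule eventually_at_rightI[of 0 1])
    fix t :: real assume "t \<in> {0<..<1}"
    then have t: "0 < t" "t < 1" by auto
    have "norm (LINT y|lborel. f y * complex_of_real (mehler t x y)) \<le> (LINT y|lborel. sqrt 2 / sqrt (1 - t) * norm (f y))"
    proof (rule Bochner_Integration.integral_norm_bound_integral)
      show "norm (f y * complex_of_real (mehler t x y)) \<le> sqrt 2 / sqrt (1 - t) * norm (f y)" for y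
        using mult_right_mono[OF mehler_bounded[OF t], of "norm (f y)"] t
        by (simp add: norm_mult mehler_nonneg mult.commute)
    qed (use f t in \<open>auto intro: integrable_mult_mehler\<close>)
    from mult_left_mono[OF this, of "t powr (2 * pi + 1 / 2)"]
    show "norm (mehler_flow f x t) \<le> t powr (2 * pi + 1 / 2) * (sqrt 2 / sqrt (1 - t) * N)"
      by (simp add: mehler_flow_def norm_mult N_def)
  qed simp
  \<comment> \<open>At base 0 continuity of \<open>powr\<close> relies on the positive exponent and
    on t approaching from the right; the limit \<open>0 powr _\<close> is 0.\<close>
  have "((\<lambda>t::real. t powr (2 * pi + 1 / 2)) \<longlongrightarrow> 0 powr (2 * pi + 1 / 2)) (at_right 0)"
    using pi_gt_zero eventually_at_right_less[of "0::real"]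
    by (intro tendsto_powr') (auto intro!: tendsto_intros elim: eventually_mono simp: add_pos_pos)
  moreover have "((\<lambda>t. sqrt 2 / sqrt (1 - t) * N) \<longlongrightarrow> sqrt 2 / sqrt (1 - 0) * N) (at_right 0)"
    by (intro tendsto_intros) auto
  ultimately show "((\<lambda>t. t powr (2 * pi + 1 / 2) * (sqrt 2 / sqrt (1 - t) * N)) \<longlongrightarrow> 0) (at_right 0)"
    using tendsto_mult by fastforce
qed

lemma integrable_gaussian_shift: "integrable lborel (\<lambda>y. exp (- (pi / 2) * (x - y)\<^sup>2))"
proof -
  have "integrable lborel (\<lambda>y::real. (1 + y\<^sup>2) * exp (- (pi / 2) * y\<^sup>2 + 0 * y))"
    by (rule integrable_one_plus_square_gaussian) simp
  then have "integrable lborel (\<lambda>y::real. exp (- (pi / 2) * y\<^sup>2))"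
    by (rule Bochner_Integration.integrable_bound) (auto intro!: AE_I2 simp: abs_mult)
  from lborel_integrable_real_affine[OF this, of "-1" x]
  show ?thesis by simp
qed

text \<open>The total mass is the Fourier transform at frequency 0. It is in general not 1 for t < 1
  and only tends to 1, so the approximate identity below compares with f x times this mass.\<close>

lemma mehler_integral:
  assumes t: "0 < t" "t < 1"
  shows "integrable lborel (mehler t x)" "complex_of_real (integral\<^sup>L lborel (mehler t x)) = mehler_hat t x 0"
    "integral\<^sup>L lborel (mehler t x) \<le> sqrt 2"
proof -
  show "integrable lborel (mehler t x)"
  proof (rule Bochner_Integration.integrable_bound)
    show "integrable lborel (\<lambda>y. sqrt 2 / sqrt (1 - t) * exp (- (pi / 2) * (x - y)\<^sup>2))"
      by (intro integrable_mult_right integrable_gaussian_shift)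
    show "AE y in lborel. norm (mehler t x y) \<le> norm (sqrt 2 / sqrt (1 - t) * exp (- (pi / 2) * (x - y)\<^sup>2))"
    proof (rule AE_I2)
      fix y
      have "\<bar>mehler t x y\<bar> = mehler t x y" using t by (simp add: mehler_nonneg)
      then show "norm (mehler t x y) \<le> norm (sqrt 2 / sqrt (1 - t) * exp (- (pi / 2) * (x - y)\<^sup>2))"
        using mehler_le[OF t, of x y] by (simp only: real_norm_def)
    qed
  qed measurable
  show *: "complex_of_real (integral\<^sup>L lborel (mehler t x)) = mehler_hat t x 0"
    using fourier_mehler[OF t, of x 0] by (simp add: fourier_def)
  have "integral\<^sup>L lborel (mehler t x) \<ge> 0"
    using t by (intro Bochner_Integration.integral_nonneg) (auto simp: mehler_nonneg)
  then have "integral\<^sup>L lborel (mehler t x) = norm (mehler_hat t x 0)"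
    by (simp only: *[symmetric] norm_of_real)
  then show "integral\<^sup>L lborel (mehler t x) \<le> sqrt 2"
    using norm_mehler_hat_le[OF t, of x 0] by simp
qed

lemma mehler_approximate_identity:
  assumes f: "integrable lborel f" and cont: "isCont f x"
  shows "((\<lambda>t. LINT y|lborel. f y * complex_of_real (mehler t x y)) \<longlongrightarrow> f x) (at_left 1)"
proof -
  define g where "g y = exp (- (pi / 2) * (x - y)\<^sup>2)" for y
  define D where "D t = (LINT y|lborel. f y * complex_of_real (mehler t x y)) - f x * mehler_hat t x 0" for t
  define B where "B = (LINT y|lborel. norm (f y)) + norm (f x) * integral\<^sup>L lborel g"
  have g: "integrable lborel g" unfolding g_def by (rule integrable_gaussian_shift)
  have D: "(D \<longlongrightarrow> 0) (at_left 1)"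
  proof (rule tendstoI)
    fix e :: real assume e: "e > 0"
    \<comment> \<open>The mass of the kernel is at most sqrt 2 < 2, so tolerance e/4 near x costs at
      most e/2.\<close>
    from cont e obtain \<delta> where \<delta>: "\<delta> > 0" "\<And>y. dist y x < \<delta> \<Longrightarrow> dist (f y) (f x) < e / 4"
      unfolding continuous_at_eps_delta by (metis divide_pos_pos zero_less_numeral)
    define \<eta> where "\<eta> t = sqrt 2 / sqrt (1 - t\<^sup>2) * exp (- pi * \<delta>\<^sup>2 * t / (1 - t))" for t
    have "(\<eta> \<longlongrightarrow> 0) (at_left 1)"
      unfolding \<eta>_def using \<delta>(1) pi_gt_zero by real_asymp
    then have "((\<lambda>t. \<eta> t * B) \<longlongrightarrow> 0) (at_left 1)"
      by (rule tendsto_mult_left_zero)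
    then have "\<forall>\<^sub>F t in at_left 1. \<eta> t * B < e / 2"
      using e by (intro order_tendstoD) auto
    moreover have "\<forall>\<^sub>F t in at_left 1. t \<in> {0<..<1::real}"
      by (rule eventually_at_leftI[of 0]) auto
    ultimately show "\<forall>\<^sub>F t in at_left 1. dist (D t) 0 < e"
    proof eventually_elim
      case (elim t)
      then have t: "0 < t" "t < 1" by auto
      have t2: "t\<^sup>2 < 1" using t by (simp add: power_less_one_iff)
      have \<eta>: "\<eta> t \<ge> 0" unfolding \<eta>_def using t2 by simp
      \<comment> \<open>The right side adds the bounds for y near x and y far from x, so the domain
        of integration need not be split. Since f may be unbounded away from x, the far part is
        measured by the L^1 norm of f.\<close>
      have le: "norm (f y * complex_of_real (mehler t x y) - f x * complex_of_real (mehler t x y))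
          \<le> e / 4 * mehler t x y + \<eta> t * (norm (f y) + norm (f x) * g y)" for y
      proof -
        have m: "0 \<le> mehler t x y" using t by (simp add: mehler_nonneg)
        have "norm (f y * complex_of_real (mehler t x y) - f x * complex_of_real (mehler t x y)) = norm (f y - f x) * mehler t x y"
          using m by (simp only: left_diff_distrib[symmetric] norm_mult norm_of_real abs_of_nonneg)
        also have "\<dots> \<le> e / 4 * mehler t x y + \<eta> t * (norm (f y) + norm (f x) * g y)"
        proof (cases "dist y x < \<delta>")
          case True
          then have "norm (f y - f x) * mehler t x y \<le> e / 4 * mehler t x y"
            using \<delta>(2)[of y] m by (intro mult_right_mono) (auto simp: dist_norm)
          moreover have "0 \<le> \<eta> t * (norm (f y) + norm (f x) * g y)"
            using \<eta> by (simp add: g_def)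
          ultimately show ?thesis by linarith
        next
          case False
          then have "mehler t x y \<le> \<eta> t * g y"
            unfolding \<eta>_def g_def using t \<delta>(1) by (intro mehler_le_away) (auto simp: dist_real_def)
          then have "norm (f y - f x) * mehler t x y \<le> (norm (f y) + norm (f x)) * (\<eta> t * g y)"
            using m by (intro mult_mono norm_triangle_ineq4) auto
          also have "\<dots> = \<eta> t * (norm (f y) * g y + norm (f x) * g y)"
            by (simp add: algebra_simps)
          also have "\<dots> \<le> \<eta> t * (norm (f y) + norm (f x) * g y)"
            using \<eta> by (intro mult_left_mono add_right_mono mult_left_le) (auto simp: g_def)
          finally show ?thesis using m e by (simp add: add_increasing)
        qed
        finally show ?thesis .
      qed
      have int: "integrable lborel (\<lambda>y. e / 4 * mehler t x y + \<eta> t * (norm (f y) + norm (f x) * g y))"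
        using mehler_integral(1)[OF t] f g by (intro Bochner_Integration.integrable_add integrable_mult_right integrable_norm)
      have fx: "integrable lborel (\<lambda>y. f x * complex_of_real (mehler t x y))"
        using mehler_integral(1)[OF t, of x] by (intro integrable_mult_right integrable_of_real)
      have "D t = (LINT y|lborel. f y * complex_of_real (mehler t x y) - f x * complex_of_real (mehler t x y))"
        unfolding D_def mehler_integral(2)[OF t, symmetric]
        by (subst Bochner_Integration.integral_diff[OF integrable_mult_mehler[OF t f] fx]) simp
      also have "norm \<dots> \<le> (LINT y|lborel. e / 4 * mehler t x y + \<eta> t * (norm (f y) + norm (f x) * g y))"
        by (intro Bochner_Integration.integral_norm_bound_integral int le Bochner_Integration.integrable_diff integrable_mult_mehler t f fx)
      also have "\<dots> = e / 4 * integral\<^sup>L lborel (mehler t x) + \<eta> t * B"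
        unfolding B_def using mehler_integral(1)[OF t] f g by simp
      also have "e / 4 * integral\<^sup>L lborel (mehler t x) \<le> e / 4 * 2"
        using mehler_integral(3)[OF t, of x] e sqrt2_less_2 by (intro mult_left_mono) auto
      finally show ?case using elim by simp
    qed
  qed
  have "((\<lambda>t. mehler_hat t x 0) \<longlongrightarrow> mehler_hat 1 x 0) (at_left 1)"
    unfolding mehler_hat_def by (intro tendsto_intros) (auto simp: add_nonneg_eq_0_iff)
  then have "((\<lambda>t. D t + f x * mehler_hat t x 0) \<longlongrightarrow> 0 + f x * mehler_hat 1 x 0) (at_left 1)"
    using D by (intro tendsto_intros)
  then show ?thesis
    by (simp add: D_def mehler_hat_def)
qed

lemma mehler_flow_at_1:
  assumes f: "integrable lborel f" and cont: "isCont f x"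
  shows "(mehler_flow f x \<longlongrightarrow> f x) (at_left 1)"
proof -
  have "((\<lambda>t::real. complex_of_real (t powr (2 * pi + 1 / 2))) \<longlongrightarrow> complex_of_real (1 powr (2 * pi + 1 / 2))) (at_left 1)"
    by (intro tendsto_intros) auto
  from tendsto_mult[OF this mehler_approximate_identity[OF assms]]
  show ?thesis by (simp add: mehler_flow_def[abs_def])
qed

subsection \<open>The integrated kernel\<close>

text \<open>With the cutoff built in, all t-integrals run over the whole line, and the values of
  \<open>mehler\<close> outside (0,1) are multiplied by 0.\<close>

definition kernel_weight :: "real \<Rightarrow> real" where
  "kernel_weight t = indicator {0<..<1} t * (pi * t powr (2 * pi - 1 / 2))"

definition mehler_kernel :: "real \<Rightarrow> real \<Rightarrow> real" where
  "mehler_kernel x y = (LINT t|lborel. kernel_weight t * mehler t x y)"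

lemma kernel_weight_measurable [measurable]: "kernel_weight \<in> borel_measurable borel"
  unfolding kernel_weight_def by measurable

lemma kernel_weight_nonneg: "0 \<le> kernel_weight t"
  by (simp add: kernel_weight_def)

lemma kernel_weight_le: "kernel_weight t \<le> pi * indicator {0<..<1} t"
proof (cases "t \<in> {0<..<1}")
  case True
  then have "t powr (2 * pi - 1 / 2) \<le> 1"
    using pi_gt3 by (intro powr_le1) auto
  then show ?thesis using True by (simp add: kernel_weight_def)
qed (simp add: kernel_weight_def)

lemma mehler_kernel_eq:
  "mehler_kernel x y = sqrt 2 * pi * exp (- pi * (x\<^sup>2 + y\<^sup>2)) *
    (LINT t:{0<..<1}|lborel. t powr (2 * pi - 1 / 2) / sqrt (1 - t\<^sup>2) *
       exp (2 * pi * ((2 * x * y * t - (x\<^sup>2 + y\<^sup>2) * t\<^sup>2) / (1 - t\<^sup>2))))"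
proof -
  have "kernel_weight t * mehler t x y = (sqrt 2 * pi * exp (- pi * (x\<^sup>2 + y\<^sup>2))) *
    (indicator {0<..<1} t *\<^sub>R (t powr (2 * pi - 1 / 2) / sqrt (1 - t\<^sup>2) *
       exp (2 * pi * ((2 * x * y * t - (x\<^sup>2 + y\<^sup>2) * t\<^sup>2) / (1 - t\<^sup>2)))))" for t
  proof (cases "t \<in> {0<..<1}")
    case True
    then have "1 - t\<^sup>2 > 0" by (simp add: power_less_one_iff)
    \<comment> \<open>From (1 + t^2)/(1 - t^2) = 1 + 2 t^2/(1 - t^2): the summand 1 yields the
      Gaussian that stands in front of the integral.\<close>
    then have "- pi * ((1 + t\<^sup>2) * (x\<^sup>2 + y\<^sup>2) - 4 * t * x * y) / (1 - t\<^sup>2)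
      = - pi * (x\<^sup>2 + y\<^sup>2) + 2 * pi * ((2 * x * y * t - (x\<^sup>2 + y\<^sup>2) * t\<^sup>2) / (1 - t\<^sup>2))"
      by (simp add: divide_simps) (simp add: algebra_simps)
    then have "mehler t x y = sqrt 2 / sqrt (1 - t\<^sup>2) * (exp (- pi * (x\<^sup>2 + y\<^sup>2))
        * exp (2 * pi * ((2 * x * y * t - (x\<^sup>2 + y\<^sup>2) * t\<^sup>2) / (1 - t\<^sup>2))))"
      unfolding mehler_def by (simp only: exp_add)
    then show ?thesis using True by (simp add: kernel_weight_def)
  qed (simp add: kernel_weight_def)
  then show ?thesis
    unfolding mehler_kernel_def set_lebesgue_integral_def by (simp only: integral_mult_right_zero)
qed

lemma integrable_inverse_sqrt: "integrable lborel (\<lambda>t::real. indicator {0<..<1} t / sqrt (1 - t))"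
proof -
  have "set_integrable lborel (einterval 0 1) (\<lambda>t::real. 1 / sqrt (1 - t))"
  proof (rule interval_integral_FTC_nonneg(1)[where F = "\<lambda>t. - 2 * sqrt (1 - t)" and A = "- 2" and B = 0])
    show "((\<lambda>t. - 2 * sqrt (1 - t)) has_real_derivative 1 / sqrt (1 - t)) (at t)" if "0 < ereal t" "ereal t < 1" for t
      using that by (auto intro!: derivative_eq_intros simp: field_simps one_ereal_def zero_ereal_def)
    show "isCont (\<lambda>t. 1 / sqrt (1 - t)) t" if "0 < ereal t" "ereal t < 1" for t
      using that by (intro continuous_intros) (auto simp: one_ereal_def zero_ereal_def)
    have "((\<lambda>t::real. - 2 * sqrt (1 - t)) \<longlongrightarrow> - 2 * sqrt (1 - 0)) (at_right 0)"
      by (intro tendsto_intros)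
    then show "(((\<lambda>t. - 2 * sqrt (1 - t)) \<circ> real_of_ereal) \<longlongrightarrow> - 2) (at_right 0)"
      unfolding zero_ereal_def by (simp add: ereal_tendsto_simps)
    have "((\<lambda>t::real. - 2 * sqrt (1 - t)) \<longlongrightarrow> - 2 * sqrt (1 - 1)) (at_left 1)"
      by (intro tendsto_intros)
    then show "(((\<lambda>t. - 2 * sqrt (1 - t)) \<circ> real_of_ereal) \<longlongrightarrow> 0) (at_left 1)"
      unfolding one_ereal_def by (simp add: ereal_tendsto_simps)
  qed (auto simp: one_ereal_def zero_ereal_def)
  moreover have "einterval 0 1 = {0<..<1}"
    by (auto simp: einterval_def one_ereal_def zero_ereal_def)
  ultimately show ?thesis by (simp add: set_integrable_def)
qed

lemma weighted_mehler_le: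
  "\<bar>kernel_weight t * mehler t x y\<bar> \<le> (pi * sqrt 2 * (indicator {0<..<1} t / sqrt (1 - t))) * exp (- (pi / 2) * (x - y)\<^sup>2)"
proof (cases "t \<in> {0<..<1}")
  case True
  then have t: "0 < t" "t < 1" by auto
  have "\<bar>kernel_weight t * mehler t x y\<bar> = kernel_weight t * mehler t x y"
    using t by (simp add: kernel_weight_nonneg mehler_nonneg)
  also have "\<dots> \<le> pi * (sqrt 2 / sqrt (1 - t) * exp (- (pi / 2) * (x - y)\<^sup>2))"
    using kernel_weight_le[of t] True t
    by (intro mult_mono mehler_le) (auto simp: mehler_nonneg)
  finally show ?thesis using True by simp
qed (simp add: kernel_weight_def)

lemma integrable_weighted_mehler: "integrable lborel (\<lambda>t. kernel_weight t * mehler t x y)"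
proof (rule Bochner_Integration.integrable_bound)
  show "integrable lborel (\<lambda>t. (pi * sqrt 2 * (indicator {0<..<1} t / sqrt (1 - t))) * exp (- (pi / 2) * (x - y)\<^sup>2))"
    by (intro integrable_mult_left integrable_mult_right integrable_inverse_sqrt)
  show "AE t in lborel. norm (kernel_weight t * mehler t x y)
      \<le> norm ((pi * sqrt 2 * (indicator {0<..<1} t / sqrt (1 - t))) * exp (- (pi / 2) * (x - y)\<^sup>2))"
    by (rule AE_I2) (simp only: real_norm_def order.trans[OF weighted_mehler_le abs_ge_self])
qed measurable

lemma mehler_kernel_bound:
  "\<exists>C\<ge>0. \<forall>y. \<bar>mehler_kernel x y\<bar> \<le> C * exp (- (pi / 2) * (x - y)\<^sup>2)"
proof (intro exI conjI allI)
  define C where "C = (LINT t|lborel. pi * sqrt 2 * (indicator {0<..<1::real} t / sqrt (1 - t)))"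
  show "C \<ge> 0"
    unfolding C_def by (intro Bochner_Integration.integral_nonneg) (auto simp: indicator_def)
  show "\<bar>mehler_kernel x y\<bar> \<le> C * exp (- (pi / 2) * (x - y)\<^sup>2)" for y
  proof -
    have "norm (mehler_kernel x y) \<le> (LINT t|lborel. (pi * sqrt 2 * (indicator {0<..<1} t / sqrt (1 - t))) * exp (- (pi / 2) * (x - y)\<^sup>2))"
      unfolding mehler_kernel_def
    proof (rule Bochner_Integration.integral_norm_bound_integral)
      show "norm (kernel_weight t * mehler t x y) \<le> (pi * sqrt 2 * (indicator {0<..<1} t / sqrt (1 - t))) * exp (- (pi / 2) * (x - y)\<^sup>2)" for t
        by (simp only: real_norm_def weighted_mehler_le)
    qed (intro integrable_weighted_mehler integrable_mult_left integrable_mult_right integrable_inverse_sqrt)+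
    also have "\<dots> = C * exp (- (pi / 2) * (x - y)\<^sup>2)"
      unfolding C_def by (rule integral_mult_left_zero)
    finally show ?thesis by simp
  qed
qed

lemma continuous_on_mehler_kernel: "continuous_on UNIV (mehler_kernel x)"
proof -
  have "isCont (mehler_kernel x) y" for y
    unfolding continuous_at_sequentially
  proof safe
    fix Y assume Y: "Y \<longlonglongrightarrow> y"
    show "(mehler_kernel x \<circ> Y) \<longlonglongrightarrow> mehler_kernel x y"
      unfolding comp_def mehler_kernel_def
    proof (rule integral_dominated_convergence[where w = "\<lambda>t. pi * sqrt 2 * (indicator {0<..<1} t / sqrt (1 - t))"])
      show "integrable lborel (\<lambda>t::real. pi * sqrt 2 * (indicator {0<..<1} t / sqrt (1 - t)))"
        by (intro integrable_mult_right integrable_inverse_sqrt)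
      show "AE t in lborel. (\<lambda>n. kernel_weight t * mehler t x (Y n)) \<longlonglongrightarrow> kernel_weight t * mehler t x y"
      proof (rule AE_I2)
        fix t
        show "(\<lambda>n. kernel_weight t * mehler t x (Y n)) \<longlonglongrightarrow> kernel_weight t * mehler t x y"
        proof (cases "t \<in> {0<..<1}")
          case True
          then have "t\<^sup>2 < 1" by (simp add: power_less_one_iff)
          then show ?thesis
            unfolding mehler_def by (intro tendsto_intros Y) auto
        qed (simp add: kernel_weight_def)
      qed
      show "AE t in lborel. norm (kernel_weight t * mehler t x (Y n)) \<le> pi * sqrt 2 * (indicator {0<..<1} t / sqrt (1 - t))" for n
      proof (rule AE_I2)
        fix t
        have "exp (- (pi / 2) * (x - Y n)\<^sup>2) \<le> 1" by simp
        then have "(pi * sqrt 2 * (indicator {0<..<1} t / sqrt (1 - t))) * exp (- (pi / 2) * (x - Y n)\<^sup>2)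
            \<le> pi * sqrt 2 * (indicator {0<..<1} t / sqrt (1 - t))"
          by (intro mult_left_le) (auto simp: indicator_def)
        with weighted_mehler_le[of t x "Y n"] show "norm (kernel_weight t * mehler t x (Y n)) \<le> pi * sqrt 2 * (indicator {0<..<1} t / sqrt (1 - t))"
          by (simp only: real_norm_def)
      qed
    qed measurable
  qed
  then show ?thesis by (simp add: continuous_on_eq_continuous_at)
qed

lemma mehler_kernel_measurable [measurable]: "mehler_kernel x \<in> borel_measurable borel"
  by (rule borel_measurable_continuous_onI[OF continuous_on_mehler_kernel])

section \<open>The Fourier transform of the integrated kernel and its decay\<close>

lemma fourier_mehler_kernel:
  "fourier (\<lambda>y. complex_of_real (mehler_kernel x y)) \<xi> = (LINT t|lborel. complex_of_real (kernel_weight t) * mehler_hat t x \<xi>)"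
proof -
  define e where "e y = exp (- (2 * complex_of_real pi * \<i> * complex_of_real \<xi> * complex_of_real y))" for y
  define F where "F t y = complex_of_real (kernel_weight t * mehler t x y) * e y" for t y
  have [measurable]: "e \<in> borel_measurable borel" unfolding e_def by measurable
  have ne: "norm (e y) = 1" for y by (simp add: e_def)
  have "integrable (lborel \<Otimes>\<^sub>M lborel) (case_prod F)"
  proof (rule integrable_product_bound)
    show "case_prod F \<in> borel_measurable (borel \<Otimes>\<^sub>M borel)"
      unfolding F_def by measurable
    show "integrable lborel (\<lambda>t::real. pi * sqrt 2 * (indicator {0<..<1} t / sqrt (1 - t)))"
      by (intro integrable_mult_right integrable_inverse_sqrt)
    show "integrable lborel (\<lambda>y. exp (- (pi / 2) * (x - y)\<^sup>2))" by (rule integrable_gaussian_shift)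
    show "norm (F t y) \<le> (pi * sqrt 2 * (indicator {0<..<1} t / sqrt (1 - t))) * exp (- (pi / 2) * (x - y)\<^sup>2)" for t y
      using weighted_mehler_le[of t x y] by (simp only: F_def norm_mult[of "complex_of_real _"] ne norm_of_real mult_1_right)
  qed
  from lborel_pair.Fubini_integral[OF this]
  have "(LINT y|lborel. LINT t|lborel. F t y) = (LINT t|lborel. LINT y|lborel. F t y)" by simp
  moreover have "(LINT t|lborel. F t y) = complex_of_real (mehler_kernel x y) * e y" for y
    unfolding F_def mehler_kernel_def by (simp only: integral_mult_left_zero integral_complex_of_real)
  moreover have "(LINT y|lborel. F t y) = complex_of_real (kernel_weight t) * mehler_hat t x \<xi>" for t
  proof (cases "t \<in> {0<..<1}")
    case True
    then show ?thesis
      using fourier_mehler[of t x \<xi>]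
      by (simp only: F_def of_real_mult mult.assoc integral_mult_right_zero e_def fourier_def) simp
  qed (simp add: F_def kernel_weight_def)
  ultimately show ?thesis by (simp add: fourier_def e_def)
qed

text \<open>The majorant carries the closed unit interval, the shape to which the fundamental
  theorem is applied next.\<close>

lemma weighted_mehler_hat_le:
  "norm (complex_of_real (kernel_weight t) * mehler_hat t x \<xi>) \<le> pi * sqrt 2 * (exp (- (pi * \<xi>\<^sup>2) * (1 - t)) * indicator {0..1} t)"
proof (cases "t \<in> {0<..<1}")
  case True
  then have "kernel_weight t * norm (mehler_hat t x \<xi>) \<le> pi * (sqrt 2 * exp (- (pi * (1 - t)) * \<xi>\<^sup>2))"
    using kernel_weight_le[of t] by (intro mult_mono norm_mehler_hat_le) auto
  moreover have "- (pi * (1 - t)) * \<xi>\<^sup>2 = - (pi * \<xi>\<^sup>2) * (1 - t)" by simp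
  ultimately show ?thesis
    using True by (simp only: norm_mult norm_of_real abs_of_nonneg[OF kernel_weight_nonneg]) simp
qed (simp add: kernel_weight_def)

text \<open>The integral I satisfies I \<le> 1 trivially and c I = 1 - exp(-c) \<le> 1 by the
  fundamental theorem. Adding the two covers c = 0 without a division.\<close>

lemma integral_exp_unit_interval:
  fixes c :: real
  assumes c: "c \<ge> 0"
  shows "integrable lborel (\<lambda>t. exp (- c * (1 - t)) * indicator {0..1} t)"
    "(1 + c) * (LINT t|lborel. exp (- c * (1 - t)) * indicator {0..1} t) \<le> 2"
proof -
  define I where "I = (LINT t|lborel. exp (- c * (1 - t)) * indicator {0..1} t)"
  have one: "integrable lborel (\<lambda>t::real. indicator {0..1} t :: real)"
    by (intro integrable_real_indicator) auto
  have le: "exp (- c * (1 - t)) * indicator {0..1} t \<le> indicator {0..1::real} t" for t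
    using c by (auto simp: indicator_def mult_nonneg_nonneg)
  show int: "integrable lborel (\<lambda>t. exp (- c * (1 - t)) * indicator {0..1} t)"
    by (rule Bochner_Integration.integrable_bound[OF one]) (use le in \<open>auto simp: indicator_def\<close>)
  have "I \<le> (LINT t|lborel. indicator {0..1::real} t)"
    unfolding I_def by (intro integral_mono int one le)
  then have "I \<le> 1" by simp
  moreover have "c * I \<le> 1"
  proof -
    have "(LINT t|lborel. c * exp (- c * (1 - t)) * indicator {0..1} t) = exp (- c * (1 - 1)) - exp (- c * (1 - 0))"
      by (rule integral_FTC_Icc_real) (auto intro!: derivative_eq_intros continuous_intros)
    moreover have "(LINT t|lborel. c * exp (- c * (1 - t)) * indicator {0..1} t) = c * I"
      unfolding I_def by (simp only: mult.assoc integral_mult_right_zero)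
    ultimately have "c * I = 1 - exp (- c)" by (simp del: mult_minus_left)
    then show ?thesis by simp
  qed
  ultimately show "(1 + c) * (LINT t|lborel. exp (- c * (1 - t)) * indicator {0..1} t) \<le> 2"
    unfolding I_def[symmetric] by (simp add: distrib_right)
qed

lemma integrable_weighted_mehler_hat_norm:
  "integrable lborel (\<lambda>t. norm (complex_of_real (kernel_weight t) * mehler_hat t x \<xi>))"
proof (rule Bochner_Integration.integrable_bound)
  show "integrable lborel (\<lambda>t. pi * sqrt 2 * (exp (- (pi * \<xi>\<^sup>2) * (1 - t)) * indicator {0..1} t))"
    by (intro integrable_mult_right integral_exp_unit_interval) auto
  show "AE t in lborel. norm (norm (complex_of_real (kernel_weight t) * mehler_hat t x \<xi>))
      \<le> norm (pi * sqrt 2 * (exp (- (pi * \<xi>\<^sup>2) * (1 - t)) * indicator {0..1} t))"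
    by (rule AE_I2) (simp only: real_norm_def abs_norm_cancel order.trans[OF weighted_mehler_hat_le abs_ge_self])
qed measurable

text \<open>The central estimate on the frequency side, with c = pi \<xi>^2: integration over t
  produces decay of order 1/(1 + \<xi>^2). It puts the kernel into the space and also justifies the
  frequency exchange in the reproducing property.\<close>

lemma integral_weighted_mehler_hat_le:
  "(1 + \<xi>\<^sup>2) * (LINT t|lborel. norm (complex_of_real (kernel_weight t) * mehler_hat t x \<xi>)) \<le> 2 * pi * sqrt 2"
proof -
  define J where "J = (LINT t|lborel. norm (complex_of_real (kernel_weight t) * mehler_hat t x \<xi>))"
  define I where "I = (LINT t|lborel. exp (- (pi * \<xi>\<^sup>2) * (1 - t)) * indicator {0..1} t)"
  have "J \<le> (LINT t|lborel. pi * sqrt 2 * (exp (- (pi * \<xi>\<^sup>2) * (1 - t)) * indicator {0..1} t))"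
    unfolding J_def
    by (intro integral_mono integrable_weighted_mehler_hat_norm integrable_mult_right integral_exp_unit_interval weighted_mehler_hat_le) auto
  also have "\<dots> = pi * sqrt 2 * I"
    unfolding I_def by (rule integral_mult_right_zero)
  finally have "J \<le> pi * sqrt 2 * I" .
  moreover have "I \<ge> 0"
    unfolding I_def by (intro Bochner_Integration.integral_nonneg) auto
  moreover have "1 * \<xi>\<^sup>2 \<le> pi * \<xi>\<^sup>2"
    using pi_gt3 by (intro mult_right_mono) auto
  ultimately have "(1 + \<xi>\<^sup>2) * J \<le> (1 + pi * \<xi>\<^sup>2) * (pi * sqrt 2 * I)"
    by (intro mult_mono) (auto simp: J_def)
  also have "\<dots> = pi * sqrt 2 * ((1 + pi * \<xi>\<^sup>2) * I)" by simp
  also have "\<dots> \<le> pi * sqrt 2 * 2"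
    unfolding I_def by (intro mult_left_mono integral_exp_unit_interval) auto
  finally show ?thesis by (simp add: J_def)
qed

subsection \<open>The reproducing property and uniqueness\<close>

text \<open>A pointwise replacement for Cauchy-Schwarz: n \<le> n^2 s + 1/s for s = 1 + x^2, from a
  square being nonnegative. It serves both for f and for its transform.\<close>

lemma integrable_of_weighted_square:
  fixes f :: "real \<Rightarrow> complex"
  assumes f: "f \<in> borel_measurable borel" and int: "integrable lborel (\<lambda>x. (cmod (f x))\<^sup>2 * (1 + x\<^sup>2))"
  shows "integrable lborel f"
proof (rule Bochner_Integration.integrable_bound)
  show "integrable lborel (\<lambda>x. (cmod (f x))\<^sup>2 * (1 + x\<^sup>2) + 1 / (1 + x\<^sup>2))"
    by (intro Bochner_Integration.integrable_add int integrable_inverse_one_plus_square)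
  show "AE x in lborel. norm (f x) \<le> norm ((cmod (f x))\<^sup>2 * (1 + x\<^sup>2) + 1 / (1 + x\<^sup>2))"
  proof (rule AE_I2)
    fix x
    have "n \<le> n\<^sup>2 * s + 1 / s" if s: "s > 0" for n s :: real
    proof -
      have "0 \<le> (n * s - 1 / 2)\<^sup>2" by simp
      then have "n * s \<le> (n * s)\<^sup>2 + 1"
        by (simp add: power2_eq_square algebra_simps)
      then show ?thesis using s by (simp add: field_simps power2_eq_square)
    qed
    from this[of "1 + x\<^sup>2" "cmod (f x)"] show "norm (f x) \<le> norm ((cmod (f x))\<^sup>2 * (1 + x\<^sup>2) + 1 / (1 + x\<^sup>2))"
      by (simp add: add_pos_nonneg)
  qed
qed (use f in simp)

lemma fourier_measurable [measurable]:
  assumes [measurable]: "f \<in> borel_measurable borel"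
  shows "fourier f \<in> borel_measurable borel"
  unfolding fourier_def by measurable

lemma sobolev_H_D:
  assumes "f \<in> sobolev_H"
  shows "continuous_on UNIV f" "f \<in> borel_measurable borel" "fourier f \<in> borel_measurable borel"
    "integrable lborel f" "integrable lborel (fourier f)"
    "integrable lborel (\<lambda>x. (cmod (f x))\<^sup>2 * (1 + x\<^sup>2))"
    "integrable lborel (\<lambda>\<xi>. (cmod (fourier f \<xi>))\<^sup>2 * (1 + \<xi>\<^sup>2))"
proof -
  show "continuous_on UNIV f" and 1: "integrable lborel (\<lambda>x. (cmod (f x))\<^sup>2 * (1 + x\<^sup>2))"
    and 2: "integrable lborel (\<lambda>\<xi>. (cmod (fourier f \<xi>))\<^sup>2 * (1 + \<xi>\<^sup>2))"
    using assms by (auto simp: sobolev_H_def)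
  then show f: "f \<in> borel_measurable borel" by (intro borel_measurable_continuous_onI)
  then show f': "fourier f \<in> borel_measurable borel" by (rule fourier_measurable)
  show "integrable lborel f" by (rule integrable_of_weighted_square[OF f 1])
  show "integrable lborel (fourier f)" by (rule integrable_of_weighted_square[OF f' 2])
qed

lemma mehler_kernel_in_sobolev_H: "(\<lambda>y. complex_of_real (mehler_kernel x y)) \<in> sobolev_H"
proof -
  obtain C where C: "C \<ge> 0" "\<And>y. \<bar>mehler_kernel x y\<bar> \<le> C * exp (- (pi / 2) * (x - y)\<^sup>2)"
    using mehler_kernel_bound by blast
  have "integrable lborel (\<lambda>y. (cmod (complex_of_real (mehler_kernel x y)))\<^sup>2 * (1 + y\<^sup>2))"
  proof (rule Bochner_Integration.integrable_bound)
    show "integrable lborel (\<lambda>y. (C\<^sup>2 * (3 + 2 * x\<^sup>2)) * exp (- (pi / 2) * (x - y)\<^sup>2))"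
      by (intro integrable_mult_right integrable_gaussian_shift)
    have "(mehler_kernel x y)\<^sup>2 * (1 + y\<^sup>2) \<le> (C\<^sup>2 * (3 + 2 * x\<^sup>2)) * exp (- (pi / 2) * (x - y)\<^sup>2)" for y
    proof -
      define E where "E = exp (- (pi / 2) * (x - y)\<^sup>2)"
      have "(mehler_kernel x y)\<^sup>2 \<le> (C * E)\<^sup>2"
        using C by (simp add: E_def abs_le_square_iff[symmetric])
      then have "(mehler_kernel x y)\<^sup>2 * (1 + y\<^sup>2) \<le> (C * E)\<^sup>2 * (1 + y\<^sup>2)"
        by (intro mult_right_mono) auto
      \<comment> \<open>One Gaussian factor absorbs the weight; the other one remains to be
        integrated.\<close>
      also have "\<dots> = C\<^sup>2 * E * ((1 + y\<^sup>2) * E)"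
        by (simp add: power2_eq_square mult_ac)
      also have "\<dots> \<le> C\<^sup>2 * E * (3 + 2 * x\<^sup>2)"
        unfolding E_def by (intro mult_left_mono one_plus_square_gaussian_le) auto
      finally show ?thesis by (simp add: E_def mult_ac)
    qed
    then show "AE y in lborel. norm ((cmod (complex_of_real (mehler_kernel x y)))\<^sup>2 * (1 + y\<^sup>2))
        \<le> norm ((C\<^sup>2 * (3 + 2 * x\<^sup>2)) * exp (- (pi / 2) * (x - y)\<^sup>2))"
      by (intro AE_I2) (simp add: abs_mult)
  qed measurable
  moreover have "integrable lborel (\<lambda>\<xi>. (cmod (fourier (\<lambda>y. complex_of_real (mehler_kernel x y)) \<xi>))\<^sup>2 * (1 + \<xi>\<^sup>2))"
  proof (rule Bochner_Integration.integrable_bound)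
    show "integrable lborel (\<lambda>\<xi>::real. (2 * pi * sqrt 2)\<^sup>2 * (1 / (1 + \<xi>\<^sup>2)))"
      by (intro integrable_mult_right integrable_inverse_one_plus_square)
    have "(cmod (fourier (\<lambda>y. complex_of_real (mehler_kernel x y)) \<xi>))\<^sup>2 * (1 + \<xi>\<^sup>2) \<le> (2 * pi * sqrt 2)\<^sup>2 * (1 / (1 + \<xi>\<^sup>2))" for \<xi>
    proof -
      define n s where "n = cmod (fourier (\<lambda>y. complex_of_real (mehler_kernel x y)) \<xi>)" and "s = 1 + \<xi>\<^sup>2"
      have s: "s > 0" by (simp add: s_def add_pos_nonneg)
      have "n \<le> (LINT t|lborel. norm (complex_of_real (kernel_weight t) * mehler_hat t x \<xi>))"
        unfolding n_def fourier_mehler_kernel by (rule integral_norm_bound)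
      then have "s * n \<le> s * (LINT t|lborel. norm (complex_of_real (kernel_weight t) * mehler_hat t x \<xi>))"
        using s by (intro mult_left_mono) auto
      also have "\<dots> \<le> 2 * pi * sqrt 2"
        unfolding s_def by (rule integral_weighted_mehler_hat_le)
      finally have "(s * n)\<^sup>2 \<le> (2 * pi * sqrt 2)\<^sup>2"
        using s by (intro power_mono) (auto simp: n_def)
      \<comment> \<open>A bound of order 1/s on the transform makes the weighted square n^2 s of
        order 1/s, which is integrable.\<close>
      then have "(s * n)\<^sup>2 / s \<le> (2 * pi * sqrt 2)\<^sup>2 / s"
        using s by (intro divide_right_mono) auto
      moreover have "(s * n)\<^sup>2 / s = n\<^sup>2 * s" using s by (simp add: power2_eq_square)
      ultimately show ?thesis by (simp add: n_def s_def)
    qed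
    then show "AE \<xi> in lborel. norm ((cmod (fourier (\<lambda>y. complex_of_real (mehler_kernel x y)) \<xi>))\<^sup>2 * (1 + \<xi>\<^sup>2))
        \<le> norm ((2 * pi * sqrt 2)\<^sup>2 * (1 / (1 + \<xi>\<^sup>2)))"
      by (intro AE_I2) (simp only: real_norm_def order.trans[OF _ abs_ge_self] abs_of_nonneg[of "_\<^sup>2 * (1 + _\<^sup>2)"] zero_le_power2 mult_nonneg_nonneg add_nonneg_nonneg zero_le_one)
  qed measurable
  moreover have "continuous_on UNIV (\<lambda>y. complex_of_real (mehler_kernel x y))"
    by (intro continuous_intros continuous_on_mehler_kernel)
  ultimately show ?thesis by (simp add: sobolev_H_def)
qed

lemma inner_H_mehler_kernel:
  assumes fH: "f \<in> sobolev_H"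
  shows "inner_H f (\<lambda>y. complex_of_real (mehler_kernel x y)) = f x"
proof -
  note [measurable] = sobolev_H_D(2,3)[OF fH]
  note f = sobolev_H_D(4)[OF fH] and fF = sobolev_H_D(5)[OF fH]
  \<comment> \<open>\<Phi> and \<Psi> are the position and frequency integrands of the inner product
    before the integration over t.\<close>
  define \<Phi> where "\<Phi> t y = complex_of_real (kernel_weight t) * (f y * complex_of_real ((1 + y\<^sup>2) * mehler t x y))" for t y
  define \<Psi> where "\<Psi> \<xi> t = (fourier f \<xi> * complex_of_real (1 + \<xi>\<^sup>2)) * cnj (complex_of_real (kernel_weight t) * mehler_hat t x \<xi>)" for \<xi> t
  have int\<Phi>: "integrable (lborel \<Otimes>\<^sub>M lborel) (case_prod \<Phi>)"
  proof (rule integrable_product_bound)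
    show "case_prod \<Phi> \<in> borel_measurable (borel \<Otimes>\<^sub>M borel)"
      unfolding \<Phi>_def by measurable
    show "integrable lborel (\<lambda>t::real. pi * sqrt 2 * (indicator {0<..<1} t / sqrt (1 - t)))"
      by (intro integrable_mult_right integrable_inverse_sqrt)
    show "integrable lborel (\<lambda>y. (3 + 2 * x\<^sup>2) * norm (f y))" using f by simp
    show "norm (\<Phi> t y) \<le> (pi * sqrt 2 * (indicator {0<..<1} t / sqrt (1 - t))) * ((3 + 2 * x\<^sup>2) * norm (f y))" for t y
    proof -
      define E where "E = exp (- (pi / 2) * (x - y)\<^sup>2)"
      define u where "u = pi * sqrt 2 * (indicator {0<..<1} t / sqrt (1 - t))"
      have u: "u \<ge> 0" by (auto simp: u_def indicator_def)
      have "norm (\<Phi> t y) = \<bar>kernel_weight t * mehler t x y\<bar> * ((1 + y\<^sup>2) * norm (f y))"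
        unfolding \<Phi>_def norm_mult norm_of_real abs_mult by (simp add: abs_of_nonneg add_nonneg_nonneg)
      also have "\<dots> \<le> (u * E) * ((1 + y\<^sup>2) * norm (f y))"
        unfolding u_def E_def by (intro mult_right_mono weighted_mehler_le) auto
      also have "\<dots> = u * (((1 + y\<^sup>2) * E) * norm (f y))" by (simp only: mult_ac)
      also have "\<dots> \<le> u * ((3 + 2 * x\<^sup>2) * norm (f y))"
        unfolding E_def using u by (intro mult_left_mono mult_right_mono one_plus_square_gaussian_le) auto
      finally show ?thesis by (simp only: u_def)
    qed
  qed
  \<comment> \<open>The available bound on \<open>mehler_hat\<close> couples \<xi> and t.
    Integrating over t first cancels the weight 1 + \<xi>^2 and leaves a multiple of the transform
    of f, which is integrable.\<close>
  have int\<Psi>: "integrable (lborel \<Otimes>\<^sub>M lborel) (case_prod \<Psi>)"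
  proof (rule lborel_pair.Fubini_integrable)
    have "case_prod \<Psi> \<in> borel_measurable (borel \<Otimes>\<^sub>M borel)"
      unfolding \<Psi>_def by measurable
    then show [measurable]: "case_prod \<Psi> \<in> borel_measurable (lborel \<Otimes>\<^sub>M lborel)"
      by (simp add: lborel_prod borel_prod)
    have nw: "norm (complex_of_real (1 + \<xi>\<^sup>2)) = 1 + \<xi>\<^sup>2" for \<xi> :: real
      by (simp only: norm_of_real) simp
    have n\<Psi>: "norm (\<Psi> \<xi> t) = (norm (fourier f \<xi>) * (1 + \<xi>\<^sup>2)) * norm (complex_of_real (kernel_weight t) * mehler_hat t x \<xi>)" for \<xi> t
      unfolding \<Psi>_def by (simp only: norm_mult[of "_ * complex_of_real (1 + _)"] norm_mult[of "fourier _ _"] complex_mod_cnj nw)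
    show "integrable lborel (\<lambda>\<xi>. LINT t|lborel. norm (case_prod \<Psi> (\<xi>, t)))"
    proof (rule Bochner_Integration.integrable_bound)
      show "integrable lborel (\<lambda>\<xi>. 2 * pi * sqrt 2 * norm (fourier f \<xi>))"
        using fF by (intro integrable_mult_right integrable_norm)
      show "AE \<xi> in lborel. norm (LINT t|lborel. norm (case_prod \<Psi> (\<xi>, t))) \<le> norm (2 * pi * sqrt 2 * norm (fourier f \<xi>))"
      proof (rule AE_I2)
        fix \<xi>
        have "(LINT t|lborel. norm (\<Psi> \<xi> t)) = norm (fourier f \<xi>) * ((1 + \<xi>\<^sup>2) * (LINT t|lborel. norm (complex_of_real (kernel_weight t) * mehler_hat t x \<xi>)))"
          unfolding n\<Psi> integral_mult_right_zero by (simp only: mult.assoc)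
        also have "\<dots> \<le> norm (fourier f \<xi>) * (2 * pi * sqrt 2)"
          by (intro mult_left_mono integral_weighted_mehler_hat_le) auto
        finally show "norm (LINT t|lborel. norm (case_prod \<Psi> (\<xi>, t))) \<le> norm (2 * pi * sqrt 2 * norm (fourier f \<xi>))"
          by (simp add: abs_mult mult_ac)
      qed
    qed measurable
    have "integrable lborel (\<lambda>t. norm (\<Psi> \<xi> t))" for \<xi>
      unfolding n\<Psi> by (intro integrable_mult_right integrable_weighted_mehler_hat_norm)
    moreover have "\<Psi> \<xi> \<in> borel_measurable lborel" for \<xi>
      unfolding \<Psi>_def by measurable
    ultimately show "AE \<xi> in lborel. integrable lborel (\<lambda>t. case_prod \<Psi> (\<xi>, t))"
      by (simp add: integrable_norm_iff)
  qed
  define g where "g t = (LINT y|lborel. \<Phi> t y) + (LINT \<xi>|lborel. \<Psi> \<xi> t)" for t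
  have int_g: "integrable lborel g"
    unfolding g_def
    by (intro Bochner_Integration.integrable_add lborel_pair.integrable_fst[OF int\<Phi>] lborel_pair.integrable_snd[OF int\<Psi>])
  have inner: "inner_H f (\<lambda>y. complex_of_real (mehler_kernel x y)) = (LINT t|lborel. g t)"
  proof -
    have "(LINT t|lborel. \<Phi> t y) = f y * cnj (complex_of_real (mehler_kernel x y)) * complex_of_real (1 + y\<^sup>2)" for y
    proof -
      have "\<Phi> t y = complex_of_real (kernel_weight t * mehler t x y) * (f y * complex_of_real (1 + y\<^sup>2))" for t
        by (simp only: \<Phi>_def of_real_mult mult_ac)
      then have "(LINT t|lborel. \<Phi> t y) = complex_of_real (mehler_kernel x y) * (f y * complex_of_real (1 + y\<^sup>2))"
        unfolding mehler_kernel_def by (simp only: integral_mult_left_zero integral_complex_of_real)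
      then show ?thesis
        by (simp only: complex_cnj_complex_of_real mult_ac)
    qed
    moreover have "(LINT t|lborel. \<Psi> \<xi> t) = fourier f \<xi> * cnj (fourier (\<lambda>y. complex_of_real (mehler_kernel x y)) \<xi>) * complex_of_real (1 + \<xi>\<^sup>2)" for \<xi>
      unfolding \<Psi>_def fourier_mehler_kernel integral_mult_right_zero Bochner_Integration.integral_cnj by (simp only: mult_ac)
    ultimately have "inner_H f (\<lambda>y. complex_of_real (mehler_kernel x y))
        = (LINT y|lborel. LINT t|lborel. \<Phi> t y) + (LINT \<xi>|lborel. LINT t|lborel. \<Psi> \<xi> t)"
      by (simp only: inner_H_def)
    also have "\<dots> = (LINT t|lborel. LINT y|lborel. \<Phi> t y) + (LINT t|lborel. LINT \<xi>|lborel. \<Psi> \<xi> t)"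
      using lborel_pair.Fubini_integral[OF int\<Phi>] lborel_pair.Fubini_integral[OF int\<Psi>] by simp
    also have "\<dots> = (LINT t|lborel. g t)"
      unfolding g_def
      by (rule Bochner_Integration.integral_add[symmetric]; intro lborel_pair.integrable_fst[OF int\<Phi>] lborel_pair.integrable_snd[OF int\<Psi>])
    finally show ?thesis .
  qed
  \<comment> \<open>At fixed t in (0,1) the frequency half becomes a y-integral with
    \<open>mehler_symbol\<close>, and the position half supplies 1 + y^2. Their sum is the integrand
    in the evolution equation.\<close>
  have g_eq: "g t = complex_of_real (pi * t powr (2 * pi - 1 / 2)) *
      (LINT y|lborel. f y * complex_of_real ((1 + y\<^sup>2 + mehler_symbol t x y) * mehler t x y))" if t: "0 < t" "t < 1" for t
  proof -
    have w: "kernel_weight t = pi * t powr (2 * pi - 1 / 2)"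
      using t by (simp add: kernel_weight_def)
    have bounded: "integrable lborel (\<lambda>y. f y * complex_of_real (h y))"
      if [measurable]: "h \<in> borel_measurable borel" and h: "\<And>y. \<bar>h y\<bar> \<le> C" for h C
    proof (rule Bochner_Integration.integrable_bound)
      show "integrable lborel (\<lambda>y. C * norm (f y))" using f by simp
      show "AE y in lborel. norm (f y * complex_of_real (h y)) \<le> norm (C * norm (f y))"
      proof (rule AE_I2)
        fix y
        have "norm (f y) * \<bar>h y\<bar> \<le> norm (f y) * C" by (intro mult_left_mono h) auto
        then show "norm (f y * complex_of_real (h y)) \<le> norm (C * norm (f y))"
          using abs_ge_self[of "C * norm (f y)"] by (simp add: norm_mult mult.commute)
      qed
    qed measurable
    have 1: "integrable lborel (\<lambda>y. f y * complex_of_real ((1 + y\<^sup>2) * mehler t x y))"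
    proof (rule bounded)
      fix y
      have "\<bar>(1 + y\<^sup>2) * mehler t x y\<bar> = (1 + y\<^sup>2) * mehler t x y"
        using t by (simp add: mehler_nonneg)
      also have "\<dots> \<le> (1 + y\<^sup>2) * (sqrt 2 / sqrt (1 - t) * exp (- (pi / 2) * (x - y)\<^sup>2))"
        by (intro mult_left_mono mehler_le t) auto
      also have "\<dots> = sqrt 2 / sqrt (1 - t) * ((1 + y\<^sup>2) * exp (- (pi / 2) * (x - y)\<^sup>2))"
        by (simp only: mult_ac)
      also have "\<dots> \<le> sqrt 2 / sqrt (1 - t) * (3 + 2 * x\<^sup>2)"
        using t by (intro mult_left_mono one_plus_square_gaussian_le) auto
      finally show "\<bar>(1 + y\<^sup>2) * mehler t x y\<bar> \<le> sqrt 2 / sqrt (1 - t) * (3 + 2 * x\<^sup>2)" .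
    qed measurable
    have 2: "integrable lborel (\<lambda>y. f y * complex_of_real ((1 + y\<^sup>2 + mehler_symbol t x y) * mehler t x y))"
      by (rule bounded[OF _ mehler_symbol_bound[OF t(1) order.refl t(2)]]) measurable
    \<comment> \<open>Written as a difference so that the subtracted term cancels the \<Phi> part of
      g.\<close>
    have split: "f y * complex_of_real (mehler_symbol t x y * mehler t x y)
        = f y * complex_of_real ((1 + y\<^sup>2 + mehler_symbol t x y) * mehler t x y) - f y * complex_of_real ((1 + y\<^sup>2) * mehler t x y)" for y
      by (simp add: algebra_simps)
    have "\<Psi> \<xi> t = complex_of_real (kernel_weight t) * (fourier f \<xi> * cnj (mehler_hat t x \<xi>) * complex_of_real (1 + \<xi>\<^sup>2))" for \<xi>
      unfolding \<Psi>_def complex_cnj_mult complex_cnj_complex_of_real by (simp only: mult_ac)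
    then have "(LINT \<xi>|lborel. \<Psi> \<xi> t) = complex_of_real (kernel_weight t) * (LINT y|lborel. f y * complex_of_real (mehler_symbol t x y * mehler t x y))"
      using fourier_pairing_mehler_hat[OF t f, of x] by (simp only: integral_mult_right_zero)
    also have "\<dots> = complex_of_real (kernel_weight t) * (LINT y|lborel. f y * complex_of_real ((1 + y\<^sup>2 + mehler_symbol t x y) * mehler t x y))
       - (LINT y|lborel. \<Phi> t y)"
      unfolding split \<Phi>_def integral_mult_right_zero Bochner_Integration.integral_diff[OF 2 1] by (simp only: right_diff_distrib)
    finally show ?thesis unfolding g_def w by simp
  qed
  \<comment> \<open>These intervals exhaust (0,1); the shift by 2 makes a 0 = b 0 = 1/2, so the
    endpoints are ordered for every n.\<close>
  define a b where "a n = 1 / real (n + 2)" and "b n = 1 - 1 / real (n + 2)" for n :: nat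
  have ab: "0 < a n" "a n \<le> b n" "b n < 1" for n
    by (auto simp: a_def b_def field_simps)
  have a0: "a \<longlonglongrightarrow> 0" and b1: "b \<longlonglongrightarrow> 1"
    unfolding a_def b_def by real_asymp+
  \<comment> \<open>g is its own majorant: its integrability over all t comes from \<Phi> and
    \<Psi>, not from the bound that degenerates at t = 1.\<close>
  have "(\<lambda>n. LINT t|lborel. indicator {a n..b n} t *\<^sub>R g t) \<longlonglongrightarrow> (LINT t|lborel. g t)"
  proof (rule integral_dominated_convergence[where w = "\<lambda>t. norm (g t)"])
    have [measurable]: "g \<in> borel_measurable borel" using int_g by simp
    show "g \<in> borel_measurable lborel" "(\<lambda>t. indicator {a n..b n} t *\<^sub>R g t) \<in> borel_measurable lborel" for n
      by measurable
    show "integrable lborel (\<lambda>t. norm (g t))" using int_g by simp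
    show "AE t in lborel. norm (indicator {a n..b n} t *\<^sub>R g t) \<le> norm (g t)" for n
      by (auto simp: indicator_def)
    show "AE t in lborel. (\<lambda>n. indicator {a n..b n} t *\<^sub>R g t) \<longlonglongrightarrow> g t"
    proof (rule AE_I2)
      fix t
      show "(\<lambda>n. indicator {a n..b n} t *\<^sub>R g t) \<longlonglongrightarrow> g t"
      proof (cases "t \<in> {0<..<1}")
        case True
        have "\<forall>\<^sub>F n in sequentially. a n < t" "\<forall>\<^sub>F n in sequentially. t < b n"
          using True a0 b1 by (auto intro: order_tendstoD)
        then have "\<forall>\<^sub>F n in sequentially. indicator {a n..b n} t *\<^sub>R g t = g t"
          by eventually_elim auto
        then show ?thesis by (rule tendsto_eventually)
      next
        case False
        then have "g t = 0" by (simp add: g_def \<Phi>_def \<Psi>_def kernel_weight_def)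
        then show ?thesis by simp
      qed
    qed
  qed
  moreover have "(LINT t|lborel. indicator {a n..b n} t *\<^sub>R g t) = mehler_flow f x (b n) - mehler_flow f x (a n)" for n
  proof -
    have "indicator {a n..b n} t *\<^sub>R g t = indicator {a n..b n} t *\<^sub>R (complex_of_real (pi * t powr (2 * pi - 1 / 2)) *
      (LINT y|lborel. f y * complex_of_real ((1 + y\<^sup>2 + mehler_symbol t x y) * mehler t x y)))" for t
      using ab[of n] by (cases "t \<in> {a n..b n}") (simp_all add: g_eq)
    then show ?thesis
      using integral_derivative_mehler_flow[OF ab f, of n x] by (simp only:)
  qed
  moreover have "(\<lambda>n. mehler_flow f x (b n) - mehler_flow f x (a n)) \<longlonglongrightarrow> f x - 0"
  proof (rule tendsto_diff)
    have "filterlim b (at_left 1) sequentially"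
      using b1 ab(3) by (auto simp: filterlim_at less_imp_neq)
    moreover have "isCont f x"
      using sobolev_H_D(1)[OF fH] by (simp add: continuous_on_eq_continuous_at)
    ultimately show "(\<lambda>n. mehler_flow f x (b n)) \<longlonglongrightarrow> f x"
      using filterlim_compose[OF mehler_flow_at_1[OF f]] by blast
    have "filterlim a (at_right 0) sequentially"
      using a0 ab(1) by (auto simp: filterlim_at less_imp_neq[THEN not_sym])
    then show "(\<lambda>n. mehler_flow f x (a n)) \<longlonglongrightarrow> 0"
      by (rule filterlim_compose[OF mehler_flow_at_0[OF f]])
  qed
  ultimately show ?thesis
    unfolding inner using LIMSEQ_unique by fastforce
qed

section \<open>Uniqueness of the reproducing kernel\<close>

lemma integrable_weighted_product:
  fixes u v :: "real \<Rightarrow> complex"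
  assumes [measurable]: "u \<in> borel_measurable borel" "v \<in> borel_measurable borel"
    and u: "integrable lborel (\<lambda>x. (cmod (u x))\<^sup>2 * (1 + x\<^sup>2))" and v: "integrable lborel (\<lambda>x. (cmod (v x))\<^sup>2 * (1 + x\<^sup>2))"
  shows "integrable lborel (\<lambda>x. u x * cnj (v x) * complex_of_real (1 + x\<^sup>2))"
proof (rule Bochner_Integration.integrable_bound)
  show "integrable lborel (\<lambda>x. (cmod (u x))\<^sup>2 * (1 + x\<^sup>2) + (cmod (v x))\<^sup>2 * (1 + x\<^sup>2))"
    by (intro Bochner_Integration.integrable_add u v)
  show "AE x in lborel. norm (u x * cnj (v x) * complex_of_real (1 + x\<^sup>2)) \<le> norm ((cmod (u x))\<^sup>2 * (1 + x\<^sup>2) + (cmod (v x))\<^sup>2 * (1 + x\<^sup>2))"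
  proof (rule AE_I2)
    fix x
    have "2 * (cmod (u x) * cmod (v x)) \<le> (cmod (u x))\<^sup>2 + (cmod (v x))\<^sup>2"
      using sum_squares_bound[of "cmod (u x)" "cmod (v x)"] by simp
    then have "cmod (u x) * cmod (v x) \<le> (cmod (u x))\<^sup>2 + (cmod (v x))\<^sup>2"
      using mult_nonneg_nonneg[OF norm_ge_zero norm_ge_zero, of "u x" "v x"] by linarith
    then have "cmod (u x) * cmod (v x) * (1 + x\<^sup>2) \<le> ((cmod (u x))\<^sup>2 + (cmod (v x))\<^sup>2) * (1 + x\<^sup>2)"
      by (intro mult_right_mono) auto
    moreover have "norm (u x * cnj (v x) * complex_of_real (1 + x\<^sup>2)) = cmod (u x) * cmod (v x) * (1 + x\<^sup>2)"
      by (simp only: norm_mult norm_of_real complex_mod_cnj) simp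
    ultimately show "norm (u x * cnj (v x) * complex_of_real (1 + x\<^sup>2)) \<le> norm ((cmod (u x))\<^sup>2 * (1 + x\<^sup>2) + (cmod (v x))\<^sup>2 * (1 + x\<^sup>2))"
      by (simp add: distrib_right)
  qed
qed measurable

text \<open>Expands one half of the squared norm of a difference. It is applied once to two kernels
  and once to their Fourier transforms.\<close>

lemma weighted_square_diff:
  fixes u v :: "real \<Rightarrow> complex"
  assumes "u \<in> borel_measurable borel" "v \<in> borel_measurable borel"
    and "integrable lborel (\<lambda>x. (cmod (u x))\<^sup>2 * (1 + x\<^sup>2))" "integrable lborel (\<lambda>x. (cmod (v x))\<^sup>2 * (1 + x\<^sup>2))"
  shows "integrable lborel (\<lambda>x. (cmod (u x - v x))\<^sup>2 * (1 + x\<^sup>2))"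
    "complex_of_real (LINT x|lborel. (cmod (u x - v x))\<^sup>2 * (1 + x\<^sup>2))
      = (LINT x|lborel. u x * cnj (u x) * complex_of_real (1 + x\<^sup>2)) - (LINT x|lborel. u x * cnj (v x) * complex_of_real (1 + x\<^sup>2))
      - (LINT x|lborel. v x * cnj (u x) * complex_of_real (1 + x\<^sup>2)) + (LINT x|lborel. v x * cnj (v x) * complex_of_real (1 + x\<^sup>2))"
proof -
  let ?p = "\<lambda>u v x. u x * cnj (v x) * complex_of_real (1 + x\<^sup>2)"
  have int: "integrable lborel (?p u u)" "integrable lborel (?p u v)" "integrable lborel (?p v u)" "integrable lborel (?p v v)"
    by (intro integrable_weighted_product assms)+
  have eq: "complex_of_real ((cmod (u x - v x))\<^sup>2 * (1 + x\<^sup>2)) = ?p u u x - ?p u v x - ?p v u x + ?p v v x" for x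
    unfolding of_real_mult complex_norm_square by (simp add: algebra_simps)
  have "integrable lborel (\<lambda>x. complex_of_real ((cmod (u x - v x))\<^sup>2 * (1 + x\<^sup>2)))"
    unfolding eq by (intro Bochner_Integration.integrable_add Bochner_Integration.integrable_diff int)
  then show "integrable lborel (\<lambda>x. (cmod (u x - v x))\<^sup>2 * (1 + x\<^sup>2))"
    by (simp only: complex_of_real_integrable_eq)
  show "complex_of_real (LINT x|lborel. (cmod (u x - v x))\<^sup>2 * (1 + x\<^sup>2))
      = (LINT x|lborel. ?p u u x) - (LINT x|lborel. ?p u v x) - (LINT x|lborel. ?p v u x) + (LINT x|lborel. ?p v v x)"
    unfolding integral_complex_of_real[symmetric] eq
    using int by simp
qed

lemma reproducing_kernel_unique:
  assumes K: "is_reproducing_kernel_at x K" and L: "is_reproducing_kernel_at x L"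
  shows "K = L"
proof -
  have KH: "K \<in> sobolev_H" and LH: "L \<in> sobolev_H"
    using K L by (auto simp: is_reproducing_kernel_at_def)
  note KD = sobolev_H_D[OF KH] and LD = sobolev_H_D[OF LH]
  define A where "A = (LINT y|lborel. (cmod (K y - L y))\<^sup>2 * (1 + y\<^sup>2))"
  define B where "B = (LINT \<xi>|lborel. (cmod (fourier K \<xi> - fourier L \<xi>))\<^sup>2 * (1 + \<xi>\<^sup>2))"
  have "complex_of_real A + complex_of_real B = inner_H K K - inner_H K L - inner_H L K + inner_H L L"
    unfolding A_def B_def inner_H_def
      weighted_square_diff(2)[OF KD(2) LD(2) KD(6) LD(6)] weighted_square_diff(2)[OF KD(3) LD(3) KD(7) LD(7)]
    by simp
  \<comment> \<open>Both kernels reproduce, so the first two terms are both K x and the last two are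
    both L x.\<close>
  also have "\<dots> = 0"
    using K L KH LH unfolding is_reproducing_kernel_at_def by auto
  finally have "A + B = 0" by (simp only: of_real_add[symmetric] of_real_eq_0_iff)
  moreover have "A \<ge> 0" "B \<ge> 0"
    unfolding A_def B_def by (auto intro!: Bochner_Integration.integral_nonneg)
  ultimately have "A = 0" by simp
  then have "AE y in lborel. (cmod (K y - L y))\<^sup>2 * (1 + y\<^sup>2) = 0"
    unfolding A_def
    by (subst (asm) integral_nonneg_eq_0_iff_AE[OF weighted_square_diff(1)[OF KD(2) LD(2) KD(6) LD(6)]]) auto
  then have "AE y in lborel. K y = L y"
    by (rule AE_mp) (auto simp: add_nonneg_eq_0_iff)
  then have "AE y in lborel. y \<in> {y. K y = L y}" by simp
  \<comment> \<open>A closed set of full measure is everything, since its open complement is null;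
    this lifts almost-everywhere equality to equality at every point.\<close>
  moreover have "closed {y. K y = L y}"
    using KD(1) LD(1) by (rule closed_Collect_eq)
  ultimately have "y \<in> {y. K y = L y}" for y
    by (intro mem_closed_if_AE_lebesgue AE_completion)
  then show ?thesis by auto
qed

theorem theorem5:
  fixes x :: real and K :: "real \<Rightarrow> complex"
  shows "is_reproducing_kernel_at x K \<longleftrightarrow>
    (\<forall>y::real. K y = complex_of_real
       (sqrt 2 * pi * exp (- pi * (x\<^sup>2 + y\<^sup>2)) *
        (LINT t:{0<..<1}|lborel.
           t powr (2 * pi - 1 / 2) / sqrt (1 - t\<^sup>2) *
           exp (2 * pi * ((2 * x * y * t - (x\<^sup>2 + y\<^sup>2) * t\<^sup>2) / (1 - t\<^sup>2))))))"
proof -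
  have "is_reproducing_kernel_at x (\<lambda>y. complex_of_real (mehler_kernel x y))"
    unfolding is_reproducing_kernel_at_def
    using mehler_kernel_in_sobolev_H inner_H_mehler_kernel by simp
  then have "is_reproducing_kernel_at x K \<longleftrightarrow> K = (\<lambda>y. complex_of_real (mehler_kernel x y))"
    using reproducing_kernel_unique by metis
  then show ?thesis
    by (simp only: mehler_kernel_eq fun_eq_iff)
qed

end
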